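(* Let $D=\{(x,y)\in\mathbb{R}^2:(x-1/2)^2+y^2\le 1/4\}$, identified with a subset of $\mathbb{C}$ via $(x,y)\leftrightarrow x+\mathrm{i}y$. Let $U\subset\mathbb{R}^2=\mathbb{C}$ be a bounded, mildly regular open set with $\operatorname{int}(D)\subset U$ and $x>0$ for all $(x,y)\in U$; $\bar U$ denotes its closure. Let $\gamma\ge 1$ and let $\mathcal{B}$ be a finite set of complex numbers with $\operatorname{Re}(b)\ge\gamma$ for all $b\in\mathcal{B}$; for $b\in\mathcal{B}$ put $\theta_b(z)=1/(z+b)$. Let $R>0$, $\alpha\ge 0$, $\mathcal{B}_R=\{b\in\mathcal{B}:|b|\le R\}$, and assume $\alpha>0$ or $\mathcal{B}_R\neq\emptyset$. For $s\ge 0$ define $L_{s,R,\alpha}:C_{\mathbb{C}}(\bar U)\to C_{\mathbb{C}}(\bar U)$ by $$(L_{s,R,\alpha}f)(z)=\sum_{b\in\mathcal{B}_R}\frac{f(\theta_b(z))}{|z+b|^{2s}}+\alpha f(0).$$ Then for each $s\ge 0$ there exists a strictly positive continuous function $w_s\in C_{\mathbb{R}}(\bar U)$, unique up to scalar multiples, with $L_{s,R,\alpha}w_s=r(L_{s,R,\alpha})w_s$, where $r(L_{s,R,\alpha})=\lim_{k\to\infty}\|L_{s,R,\alpha}^k\|^{1/k}>0$. If $\mathcal{B}$ and $U$ are symmetric under conjugation, then $w_s(\bar z)=w_s(z)$ for all $z\in\bar U$. Moreover, writing $w_s(x,y)=w_s(x+\mathrm{i}y)$, $w_s$ is $C^\infty$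 on $\bar U$ and: (i) $w_s(z_0)\le w_s(z_1)\exp[(\sqrt5 s/\gamma)|z_1-z_0|]$ for all $z_0,z_1\in\bar U$; (ii) $w_s(x_1,y)\ge w_s(x_2,y)\ge w_s(x_1,y)\exp[(-2s/\gamma)(x_2-x_1)]$ whenever $0\le x_1\le x_2$ and $(x_1,y),(x_2,y)\in\bar U$; (iii) $w_s(x,y_1)\le w_s(x,y_2)\exp[(s/\gamma)|y_1-y_2|]$ whenever $(x,y_1),(x,y_2)\in\bar U$; (iv) $-\frac{s}{4\gamma^2(s+1)}w_s(x,y)\le D_{xx}w_s(x,y)\le\frac{2s(2s+1)}{\gamma^2}w_s(x,y)$; (v) $-\frac{2s}{\gamma^2}w_s(x,y)\le D_{yy}w_s(x,y)\le\frac{2s(2s+1)}{4\gamma^2}w_s(x,y)$, with (iv),(v) holding for $(x,y)\in\bar U$.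
   Context: A bounded open set $H\subset\mathbb{R}^n$ is mildly regular if there exist $\eta>0$ and $M\ge1$ such that whenever $x,y\in H$ and $\|x-y\|<\eta$, there is a Lipschitz map $\psi:[0,1]\to H$ with $\psi(0)=x$, $\psi(1)=y$ and $\int_0^1\|\psi'(t)\|\,dt\le M\|x-y\|$. $C_{\mathbb{C}}(\bar U)$ (resp. $C_{\mathbb{R}}(\bar U)$) is the Banach space of continuous complex- (resp. real-) valued functions on $\bar U$ with the sup norm. A set $S\subset\mathbb{C}$ is symmetric under conjugation if $S=\{\bar z:z\in S\}$. $D_{xx}=\partial^2/\partial x^2$, $D_{yy}=\partial^2/\partial y^2$; "$C^\infty$ on $\bar U$" means all partial derivatives exist on $U$ and extend continuously to $\bar U$. *)

theory Defs
  imports "HOL-Analysis.Analysis"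
begin

definition mildly_regular :: "'a::euclidean_space set \<Rightarrow> bool" where
  "mildly_regular H \<longleftrightarrow> bounded H \<and> open H \<and>
     (\<exists>\<eta>>0. \<exists>M\<ge>1. \<forall>x\<in>H. \<forall>y\<in>H. norm (x - y) < \<eta> \<longrightarrow>
        (\<exists>\<psi> \<psi>' C N. C-lipschitz_on {0..1} \<psi> \<and> \<psi> ` {0..1} \<subseteq> H \<and>
           \<psi> 0 = x \<and> \<psi> 1 = y \<and> N \<in> null_sets lborel \<and>
           (\<forall>t\<in>{0<..<1} - N. (\<psi> has_vector_derivative \<psi>' t) (at t)) \<and>
           set_integrable lborel {0..1::real} (\<lambda>t. norm (\<psi>' t)) \<and>
           (LINT t:{0..1}|lborel. norm (\<psi>' t)) \<le> M * norm (x - y)))"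

definition diskD :: "complex set" where
  "diskD = {z. (Re z - 1/2)^2 + (Im z)^2 \<le> 1/4}"

definition Lop :: "complex set \<Rightarrow> real \<Rightarrow> real \<Rightarrow> real \<Rightarrow> (complex \<Rightarrow> complex) \<Rightarrow> complex \<Rightarrow> complex" where
  "Lop B R \<alpha> s f z =
     (\<Sum>b\<in>{b\<in>B. cmod b \<le> R}. f (1 / (z + b)) / complex_of_real (cmod (z + b) powr (2 * s)))
     + complex_of_real \<alpha> * f 0"

definition supn :: "complex set \<Rightarrow> (complex \<Rightarrow> complex) \<Rightarrow> real" where
  "supn S f = Sup ((\<lambda>z. cmod (f z)) ` S)"

definition opnorm_pow :: "complex set \<Rightarrow> ((complex \<Rightarrow> complex) \<Rightarrow> (complex \<Rightarrow> complex)) \<Rightarrow> nat \<Rightarrow> real" where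
  "opnorm_pow S T k = Sup {supn S ((T ^^ k) f) | f. continuous_on S f \<and> supn S f \<le> 1}"

text \<open>Partial derivative of a real-valued function on the plane in direction d
  (d = 1 gives D_x, d = i gives D_y), and iterated partial derivatives.\<close>
definition pdir :: "complex \<Rightarrow> (complex \<Rightarrow> real) \<Rightarrow> complex \<Rightarrow> real" where
  "pdir d g z = deriv (\<lambda>t::real. g (z + complex_of_real t * d)) 0"

fun pder :: "complex list \<Rightarrow> (complex \<Rightarrow> real) \<Rightarrow> complex \<Rightarrow> real" where
  "pder [] g = g"
| "pder (d # ds) g = pdir d (pder ds g)"

end

theory Submission
  imports Defs
begin

text \<open>
  Write \<open>K(\<zeta>) = |\<zeta>|\<^sup>-\<^sup>2\<^sup>s\<close>. The identity \<open>K(z + b) K(1/(z + b) + \<beta>) = K(\<beta>) K(z + b + 1/\<beta>)\<close> shows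
  that \<open>L\<close> preserves the cone generated by the constants and the functions \<open>z \<mapsto> K(z + \<beta>)\<close> with
  \<open>Re \<beta> \<ge> \<gamma>\<close>; it contains all iterates \<open>m\<^sub>k = L\<^sup>k 1\<close>. Every linear inequality that holds for
  the generators, including bounds on partial derivatives, therefore holds for each \<open>m\<^sub>k\<close>.
  The resulting Harnack inequality makes \<open>m\<^sub>k(0)\<close> quasi-multiplicative, so \<open>m\<^sub>k\<close> is comparable to
  \<open>r\<^sup>k\<close> uniformly in \<open>k\<close>, and \<open>w(z)\<close> is the Banach limit of \<open>m\<^sub>k(z) / r\<^sup>k\<close>: shift invariance gives
  \<open>L w = r w\<close>, positivity transfers the inequalities, and uniform bounds on the next two derivatives
  permit differentiating under the limit. For uniqueness, subtract from a second eigenfunction the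
  largest multiple of \<open>w\<close> below it; the difference vanishes along an orbit of the contracting
  branches \<open>\<theta>\<^sub>b\<close>, which all other orbits approach, hence everywhere.
\<close>

subsection \<open>Banach limits\<close>

text \<open>The operator is in general not compact on continuous functions, and convergence of
  \<open>m k / r ^ k\<close> is not known in advance. A Banach limit needs only boundedness, so
  two-sided pointwise bounds already produce an eigenfunction. The price is that such a limit
  preserves neither continuity nor differentiability by itself. Hence every derivative of
  \<open>m k\<close> is bounded by a multiple of \<open>m k\<close>, uniformly in \<open>k\<close>.
  Such relative bounds exist because each derivative of the kernel, divided by the kernel, is a
  polynomial in the coordinates of \<open>1/\<zeta>\<close>, and these are bounded away from the
  origin. The same coordinates explain the constants in (iv) and (v): inversion carries
  \<open>Re \<zeta> \<ge> \<gamma>\<close> into the disk with diameter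
  \<open>[0, 1/\<gamma>]\<close>, and the constants come from estimating two quadratic forms on that
  disk. The cone lives on a fixed half-plane containing the closure of \<open>U\<close>, so its
  estimates do not depend on the shape of \<open>U\<close>.\<close>

lemma Bseq_add2:
  fixes x y :: "nat \<Rightarrow> 'a::real_normed_vector"
  assumes "Bseq x" "Bseq y"
  shows "Bseq (\<lambda>n. x n + y n)"
proof -
  obtain K L where "\<And>n. norm (x n) \<le> K" "\<And>n. norm (y n) \<le> L"
    using assms by (auto simp: Bseq_def)
  then have "norm (x n + y n) \<le> K + L" for n
    by (meson norm_triangle_mono)
  then show ?thesis by (rule BseqI')
qed

locale banach_limit =
  fixes Lm :: "(nat \<Rightarrow> real) \<Rightarrow> real"
  assumes add: "Bseq x \<Longrightarrow> Bseq y \<Longrightarrow> Lm (\<lambda>n. x n + y n) = Lm x + Lm y"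
    and scale: "Bseq x \<Longrightarrow> Lm (\<lambda>n. c * x n) = c * Lm x"
    and ge: "Bseq x \<Longrightarrow> (\<And>n. a \<le> x n) \<Longrightarrow> a \<le> Lm x"
    and le: "Bseq x \<Longrightarrow> (\<And>n. x n \<le> a) \<Longrightarrow> Lm x \<le> a"
    and shift: "Bseq x \<Longrightarrow> Lm (\<lambda>n. x (Suc n)) = Lm x"

text \<open>The Cesaro averages lie in a compact product of intervals (Tychonoff);
  any cluster point of them is a Banach limit.\<close>

lemma banach_limit_exists: "\<exists>Lm. banach_limit Lm"
proof -
  define bd :: "(nat \<Rightarrow> real) \<Rightarrow> real" where "bd x = (SOME K. \<forall>n. \<bar>x n\<bar> \<le> K)" for x
  have bd: "\<bar>x n\<bar> \<le> bd x" if "Bseq x" for x n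
  proof -
    have "\<exists>K. \<forall>n. \<bar>x n\<bar> \<le> K" using that by (auto simp: Bseq_def)
    from someI_ex[OF this] show ?thesis by (simp add: bd_def)
  qed
  define avg :: "nat \<Rightarrow> (nat \<Rightarrow> real) \<Rightarrow> real"
    where "avg n x = (if Bseq x then (\<Sum>k\<le>n. x k) / real (Suc n) else 0)" for n x
  \<comment> \<open>The absolute value keeps each interval nonempty also for unbounded sequences,
    where \<open>bd\<close> is an arbitrary number and \<open>avg\<close> takes the default value
    0.\<close>
  define X :: "((nat \<Rightarrow> real) \<Rightarrow> real) set"
    where "X = PiE UNIV (\<lambda>x. {- \<bar>bd x\<bar>..\<bar>bd x\<bar>})"
  have avg_le: "avg n x \<le> a" if "Bseq x" "\<And>n. x n \<le> a" for n x a
  proof -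
    have "(\<Sum>k\<le>n. x k) \<le> real (Suc n) * a"
      using sum_bounded_above[of "{..n}" x a] that(2) by simp
    then show ?thesis using that(1)
      unfolding avg_def by (simp add: divide_le_eq mult.commute del: of_nat_Suc)
  qed
  have avg_ge: "a \<le> avg n x" if "Bseq x" "\<And>n. a \<le> x n" for n x a
  proof -
    have "real (Suc n) * a \<le> (\<Sum>k\<le>n. x k)"
      using sum_bounded_below[of "{..n}" a x] that(2) by simp
    then show ?thesis using that(1)
      unfolding avg_def by (simp add: le_divide_eq mult.commute del: of_nat_Suc)
  qed
  have avgX: "avg n \<in> X" for n
  proof -
    have "avg n x \<in> {- \<bar>bd x\<bar>..\<bar>bd x\<bar>}" for x
    proof (cases "Bseq x")
      case True
      have "x n \<le> \<bar>bd x\<bar>" "- \<bar>bd x\<bar> \<le> x n" for n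
        using bd[OF True, of n] by linarith+
      then show ?thesis using avg_le[OF True, of "\<bar>bd x\<bar>"] avg_ge[OF True, of "- \<bar>bd x\<bar>"] by simp
    qed (simp add: avg_def)
    then show ?thesis unfolding X_def by (auto simp: PiE_iff)
  qed
  have "compactin (product_topology (\<lambda>_::nat \<Rightarrow> real. (euclidean :: real topology)) UNIV) X"
    unfolding X_def compactin_PiE by simp
  then have cX: "compact X" by (simp add: euclidean_product_topology)
  define F where "F n = closure (avg ` {n..}) " for n
  have "X \<inter> (\<Inter>n. F n) \<noteq> {}"
  proof (rule compact_imp_fip_image[OF cX])
    show "closed (F n)" for n by (simp add: F_def)
    fix I :: "nat set" assume I: "finite I"
    obtain N where N: "\<forall>n\<in>I. n \<le> N" using I finite_nat_set_iff_bounded_le by blast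
    have "avg N \<in> F n" if "n \<in> I" for n
      using that N closure_subset unfolding F_def by fastforce
    then show "X \<inter> (\<Inter>n\<in>I. F n) \<noteq> {}" using avgX by blast
  qed
  then obtain Lm where Lm: "\<And>n. Lm \<in> F n" by blast
  \<comment> \<open>Every closed condition satisfied by all sufficiently late averages passes to
    \<open>Lm\<close>; each axiom below is such a condition, since evaluation at a sequence is
    continuous in the product topology.\<close>
  have limit: "Lm \<in> C" if "closed C" "\<And>k. k \<ge> n \<Longrightarrow> avg k \<in> C" for C n
    using Lm[of n] closure_minimal[of "avg ` {n..}" C] that unfolding F_def by blast
  have ev: "continuous_on UNIV (\<lambda>L::(nat \<Rightarrow> real) \<Rightarrow> real. L x)" for x
    by (rule continuous_on_product_coordinates)
  have "banach_limit Lm"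
  proof
    fix x y :: "nat \<Rightarrow> real" assume xy: "Bseq x" "Bseq y"
    have s: "Bseq (\<lambda>n. x n + y n)"
      using xy by (rule Bseq_add2)
    have "Lm \<in> {L. L (\<lambda>n. x n + y n) = L x + L y}"
    proof (rule limit[of _ 0])
      show "closed {L::(nat \<Rightarrow> real) \<Rightarrow> real. L (\<lambda>n. x n + y n) = L x + L y}"
        by (intro closed_Collect_eq ev continuous_intros)
      show "avg k \<in> {L. L (\<lambda>n. x n + y n) = L x + L y}" for k
        using xy s by (simp add: avg_def sum.distrib add_divide_distrib)
    qed
    then show "Lm (\<lambda>n. x n + y n) = Lm x + Lm y" by simp
  next
    fix c :: real and x :: "nat \<Rightarrow> real" assume x: "Bseq x"
    have s: "Bseq (\<lambda>n. c * x n)"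
      using x by (intro Bseq_mult) auto
    have "Lm \<in> {L. L (\<lambda>n. c * x n) = c * L x}"
    proof (rule limit[of _ 0])
      show "closed {L::(nat \<Rightarrow> real) \<Rightarrow> real. L (\<lambda>n. c * x n) = c * L x}"
        by (intro closed_Collect_eq ev continuous_intros)
      show "avg k \<in> {L. L (\<lambda>n. c * x n) = c * L x}" for k
        using x s by (simp add: avg_def sum_distrib_left)
    qed
    then show "Lm (\<lambda>n. c * x n) = c * Lm x" by simp
  next
    fix a :: real and x :: "nat \<Rightarrow> real" assume x: "Bseq x" "\<And>n. a \<le> x n"
    have "Lm \<in> {L. a \<le> L x}"
      by (rule limit[of _ 0]) (auto intro!: closed_Collect_le ev continuous_intros avg_ge x)
    then show "a \<le> Lm x" by simp
  next
    fix a :: real and x :: "nat \<Rightarrow> real" assume x: "Bseq x" "\<And>n. x n \<le> a"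
    have "Lm \<in> {L. L x \<le> a}"
      by (rule limit[of _ 0]) (auto intro!: closed_Collect_le ev continuous_intros avg_le x)
    then show "Lm x \<le> a" by simp
  next
    fix x :: "nat \<Rightarrow> real" assume x: "Bseq x"
    have s: "Bseq (\<lambda>n. x (Suc n))" using x by (simp add: Bseq_Suc_iff)
    \<comment> \<open>Averages are only asymptotically shift invariant: the difference telescopes to
      two end terms. The bound is stated with a fixed \<open>n\<close> so that it is a closed
      condition valid for all \<open>k \<ge> n\<close>; afterwards \<open>n\<close> tends to
      infinity.\<close>
    have diff: "\<bar>avg k (\<lambda>n. x (Suc n)) - avg k x\<bar> \<le> 2 * bd x / real (Suc n)" if "n \<le> k" for k n
    proof -
      have "(\<Sum>i\<le>k. x (Suc i)) - (\<Sum>i\<le>k. x i) = x (Suc k) - x 0"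
        by (induction k) auto
      then have "avg k (\<lambda>n. x (Suc n)) - avg k x = (x (Suc k) - x 0) / real (Suc k)"
        using x s by (simp add: avg_def diff_divide_distrib[symmetric])
      also have "\<bar>\<dots>\<bar> \<le> 2 * bd x / real (Suc k)"
        using bd[OF x, of "Suc k"] bd[OF x, of 0] by (simp add: divide_right_mono abs_divide)
      also have "\<dots> \<le> 2 * bd x / real (Suc n)"
        using that bd[OF x, of 0] by (intro divide_left_mono) auto
      finally show ?thesis .
    qed
    have "\<bar>Lm (\<lambda>n. x (Suc n)) - Lm x\<bar> \<le> 2 * bd x / real (Suc n)" for n
    proof -
      have "Lm \<in> {L. \<bar>L (\<lambda>n. x (Suc n)) - L x\<bar> \<le> 2 * bd x / real (Suc n)}"
        by (rule limit[of _ n]) (use diff[of n] in \<open>auto intro!: closed_Collect_le ev continuous_intros simp del: of_nat_Suc\<close>)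
      then show ?thesis by simp
    qed
    moreover have "(\<lambda>n. 2 * bd x / real (Suc n)) \<longlonglongrightarrow> 0"
      using LIMSEQ_Suc[OF lim_const_over_n[of "2 * bd x"]] by simp
    ultimately have "\<bar>Lm (\<lambda>n. x (Suc n)) - Lm x\<bar> \<le> 0"
      by (intro LIMSEQ_le_const) auto
    then show "Lm (\<lambda>n. x (Suc n)) = Lm x" by simp
  qed
  then show ?thesis by blast
qed

context banach_limit
begin

lemma diff: "Bseq x \<Longrightarrow> Bseq y \<Longrightarrow> Lm (\<lambda>n. x n - y n) = Lm x - Lm y"
  using add[of x "\<lambda>n. - 1 * y n"] scale[of y "-1"] Bseq_minus_iff[of y] by simp

lemma mono:
  assumes "Bseq x" "Bseq y" "\<And>n. x n \<le> y n"
  shows "Lm x \<le> Lm y"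
proof -
  have "Bseq (\<lambda>n. y n - x n)"
    using Bseq_add2[OF assms(2), of "\<lambda>n. - x n"] assms(1) Bseq_minus_iff[of x] by simp
  then have "0 \<le> Lm (\<lambda>n. y n - x n)" using assms by (intro ge) auto
  then show ?thesis using diff assms by simp
qed

lemma Bseq_sum:
  assumes "finite I" "\<And>i. i \<in> I \<Longrightarrow> Bseq (x i)"
  shows "Bseq (\<lambda>n. \<Sum>i\<in>I. x i n :: real)"
  using assms by (induction I rule: finite_induct) (auto intro: Bseq_add2)

lemma sum:
  assumes "finite I" "\<And>i. i \<in> I \<Longrightarrow> Bseq (x i)"
  shows "Lm (\<lambda>n. \<Sum>i\<in>I. x i n) = (\<Sum>i\<in>I. Lm (x i))"
  using assms
proof (induction I rule: finite_induct)
  case empty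
  show ?case using scale[of "\<lambda>_. 0" 0] by simp
next
  case (insert i I)
  then show ?case using add[of "x i" "\<lambda>n. \<Sum>i\<in>I. x i n"] Bseq_sum[of I x] by simp
qed

lemma abs_le:
  assumes "Bseq x" "\<And>n. \<bar>x n\<bar> \<le> a"
  shows "\<bar>Lm x\<bar> \<le> a"
proof -
  have "x n \<le> a" "- a \<le> x n" for n using assms(2)[of n] by linarith+
  then show ?thesis using le[OF assms(1), of a] ge[OF assms(1), of "- a"] by simp
qed

text \<open>A bound on the second derivatives that is uniform in \<open>k\<close> makes the
  first-order Taylor remainder at 0 at most \<open>C * t^2\<close> for all \<open>k\<close> at once.
  This estimate survives a positive linear functional, whereas pointwise differentiability alone
  would not.\<close>

lemma has_real_derivative:
  fixes v v' v'' :: "nat \<Rightarrow> real \<Rightarrow> real"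
  assumes e: "e > 0"
    and v: "\<And>k t. \<bar>t\<bar> < e \<Longrightarrow> (v k has_real_derivative v' k t) (at t)"
    and v': "\<And>k t. \<bar>t\<bar> < e \<Longrightarrow> (v' k has_real_derivative v'' k t) (at t)"
    and C: "\<And>k t. \<bar>t\<bar> < e \<Longrightarrow> \<bar>v'' k t\<bar> \<le> C"
    and B: "\<And>t. \<bar>t\<bar> < e \<Longrightarrow> Bseq (\<lambda>k. v k t)" "Bseq (\<lambda>k. v' k 0)"
  shows "((\<lambda>t. Lm (\<lambda>k. v k t)) has_real_derivative Lm (\<lambda>k. v' k 0)) (at 0)"
proof -
  let ?L = "\<lambda>t. Lm (\<lambda>k. v k t)" and ?D = "Lm (\<lambda>k. v' k 0)"
  have S: "convex {-e<..<e}" by simp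
  have taylor: "\<bar>v k t - v k 0 - t * v' k 0\<bar> \<le> C * t^2" if t: "\<bar>t\<bar> < e" for k t
  proof -
    have C0: "C \<ge> 0" using C[of 0 k] e by force
    have d': "\<bar>v' k u - v' k 0\<bar> \<le> C * \<bar>t\<bar>" if u: "\<bar>u\<bar> \<le> \<bar>t\<bar>" for u
    proof -
      have "norm (v' k u - v' k 0) \<le> C * norm (u - 0)"
        using v' C e t u
        by (intro field_differentiable_bound[OF S, of _ "v'' k"])
          (auto intro: has_field_derivative_at_within)
      also have "\<dots> \<le> C * \<bar>t\<bar>" using u C0 by (simp add: mult_left_mono)
      finally show ?thesis by simp
    qed
    have "norm ((v k t - t * v' k 0) - (v k 0 - 0 * v' k 0)) \<le> (C * \<bar>t\<bar>) * norm (t - 0)"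
    proof (rule field_differentiable_bound[of "{-\<bar>t\<bar>..\<bar>t\<bar>}" _ "\<lambda>u. v' k u - v' k 0"])
      fix u assume "u \<in> {-\<bar>t\<bar>..\<bar>t\<bar>}"
      then have u: "\<bar>u\<bar> \<le> \<bar>t\<bar>" by auto
      show "((\<lambda>u. v k u - u * v' k 0) has_real_derivative v' k u - v' k 0) (at u within {-\<bar>t\<bar>..\<bar>t\<bar>})"
        using v[of u k] u t
        by (intro has_field_derivative_at_within[where s = "{-\<bar>t\<bar>..\<bar>t\<bar>}"])
          (auto intro!: derivative_eq_intros)
      show "norm (v' k u - v' k 0) \<le> C * \<bar>t\<bar>" using d'[OF u] by simp
    qed auto
    then show ?thesis by (simp add: power2_eq_square algebra_simps)
  qed
  have lim: "\<bar>?L t - ?L 0 - t * ?D\<bar> \<le> C * t^2" if t: "\<bar>t\<bar> < e" for t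
  proof -
    have b: "Bseq (\<lambda>k. v k t)" "Bseq (\<lambda>k. v k 0)" "Bseq (\<lambda>k. t * v' k 0)"
      using B t e by (auto intro: Bseq_mult)
    have b2: "Bseq (\<lambda>k. v k t - v k 0)"
      using Bseq_add2[OF b(1), of "\<lambda>k. - v k 0"] Bseq_minus_iff[of "\<lambda>k. v k 0"] b(2) by simp
    have b3: "Bseq (\<lambda>k. v k t - v k 0 - t * v' k 0)"
      using Bseq_add2[OF b2, of "\<lambda>k. - (t * v' k 0)"] Bseq_minus_iff[of "\<lambda>k. t * v' k 0"] b(3) by simp
    have "Lm (\<lambda>k. v k t - v k 0 - t * v' k 0) = ?L t - ?L 0 - t * ?D"
      using diff[OF b2 b(3)] diff[OF b(1,2)] scale[OF B(2), of t] by simp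
    then show ?thesis using abs_le[OF b3 taylor[OF t]] by simp
  qed
  have "((\<lambda>h. (?L (0 + h) - ?L 0) / h - ?D) \<longlongrightarrow> 0) (at 0)"
  proof (rule Lim_null_comparison)
    have "eventually (\<lambda>h::real. h \<in> {-e<..<e}) (at 0)"
      using e by (intro eventually_at_in_open') auto
    moreover have "eventually (\<lambda>h::real. h \<noteq> 0) (at 0)" by (simp add: eventually_at_filter)
    ultimately show "eventually (\<lambda>h. norm ((?L (0 + h) - ?L 0) / h - ?D) \<le> C * \<bar>h\<bar>) (at 0)"
    proof eventually_elim
      case (elim h)
      have "(?L (0 + h) - ?L 0) / h - ?D = (?L h - ?L 0 - h * ?D) / h"
        using elim by (simp add: field_simps)
      also have "norm \<dots> \<le> C * h^2 / \<bar>h\<bar>"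
        using lim[of h] elim unfolding real_norm_def abs_divide
        by (intro divide_right_mono) auto
      also have "\<dots> = C * \<bar>h\<bar>" using elim by (simp add: power2_eq_square abs_if)
      finally show ?case .
    qed
    have "((\<lambda>h::real. C * \<bar>h\<bar>) \<longlongrightarrow> C * \<bar>0\<bar>) (at 0)" by (intro tendsto_intros)
    then show "((\<lambda>h::real. C * \<bar>h\<bar>) \<longlongrightarrow> 0) (at 0)" by simp
  qed
  then show ?thesis unfolding DERIV_def by (simp add: LIM_zero_iff)
qed

end

subsection \<open>Quasi-multiplicative sequences\<close>

text \<open>Two-sided form of Fekete's argument: \<open>ln (H * a k)\<close> is subadditive and
  \<open>ln (a k / H)\<close> is superadditive, so one slope separates the two families and controls
  \<open>a k\<close> up to the fixed factor \<open>H\<close>.\<close>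

lemma quasi_multiplicative_growth:
  fixes a :: "nat \<Rightarrow> real"
  assumes pos: "\<And>k. a k > 0" and H: "H \<ge> 1" and "a 0 = 1"
    and upper: "\<And>k l. a (k + l) \<le> H * a k * a l"
    and lower: "\<And>k l. a k * a l \<le> H * a (k + l)"
  obtains r where "r > 0" "\<And>k. r ^ k \<le> H * a k" "\<And>k. a k \<le> H * r ^ k"
proof -
  define c where "c k = ln (H * a k)" for k
  define d where "d k = ln (a k / H)" for k
  have Hp: "H > 0" using H by simp
  \<comment> \<open>The case \<open>k = 0\<close> is excluded because \<open>c 0 = ln H\<close> may
    be positive.\<close>
  have c_pow: "c (k * l) \<le> real k * c l" if "k \<ge> 1" for k l
    using that
  proof (induction k rule: dec_induct)
    case (step n)
    have "H * a (l + n * l) \<le> (H * a l) * (H * a (n * l))"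
      using upper[of l "n * l"] Hp by (simp add: mult.assoc mult.left_commute)
    then have "c (l + n * l) \<le> ln ((H * a l) * (H * a (n * l)))"
      unfolding c_def using Hp pos by (subst ln_le_cancel_iff) auto
    also have "\<dots> = c l + c (n * l)"
      unfolding c_def using Hp pos by (subst ln_mult) (auto simp: less_imp_neq[symmetric])
    finally show ?case using step.IH by (simp add: algebra_simps)
  qed simp
  have d_pow: "d (k * l) \<ge> real k * d l" if "k \<ge> 1" for k l
    using that
  proof (induction k rule: dec_induct)
    case (step n)
    have "(a l / H) * (a (n * l) / H) \<le> a (l + n * l) / H"
      using lower[of l "n * l"] Hp by (simp add: field_simps)
    then have "ln ((a l / H) * (a (n * l) / H)) \<le> d (l + n * l)"
      unfolding d_def using Hp pos by (subst ln_le_cancel_iff) auto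
    moreover have "ln ((a l / H) * (a (n * l) / H)) = d l + d (n * l)"
      unfolding d_def using Hp pos by (subst ln_mult) (auto simp: less_imp_neq[symmetric])
    ultimately show ?case using step.IH by (simp add: algebra_simps)
  qed simp
  have dc: "d k \<le> c k" for k
  proof -
    have "a k / H \<le> H * a k"
    proof -
      have "a k \<le> H * H * a k" using H pos[of k] by (simp add: mult_ge1_I)
      then show ?thesis using Hp by (simp add: field_simps)
    qed
    then show ?thesis unfolding c_def d_def using Hp pos by (subst ln_le_cancel_iff) auto
  qed
  \<comment> \<open>Both slopes are compared at the common index \<open>l * k\<close>.\<close>
  have cross: "d k / real k \<le> c l / real l" if "k \<ge> 1" "l \<ge> 1" for k l
  proof -
    have "real l * d k \<le> real k * c l"
      using d_pow[OF that(2), of k] dc[of "l * k"] c_pow[OF that(1), of l]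
      by (simp add: mult.commute)
    then show ?thesis using that by (simp add: field_simps)
  qed
  define \<rho> where "\<rho> = Inf ((\<lambda>l. c l / real l) ` {1..})"
  have lo: "d k / real k \<le> \<rho>" if "k \<ge> 1" for k
    unfolding \<rho>_def using cross[OF that] by (intro cINF_greatest) auto
  have up: "\<rho> \<le> c k / real k" if "k \<ge> 1" for k
    unfolding \<rho>_def using cross[of 1] that
    by (intro cINF_lower bdd_belowI2[of _ "d 1 / real 1"]) auto
  show thesis
  proof
    show "exp \<rho> > 0" by simp
    fix k
    show "exp \<rho> ^ k \<le> H * a k"
    proof (cases "k = 0")
      case False
      then have "real k * \<rho> \<le> ln (H * a k)" using up[of k] by (simp add: c_def field_simps)
      then have "exp (real k * \<rho>) \<le> exp (ln (H * a k))" by simp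
      then show ?thesis using Hp pos[of k] by (simp add: exp_of_nat_mult)
    qed (use H \<open>a 0 = 1\<close> in simp)
    show "a k \<le> H * exp \<rho> ^ k"
    proof (cases "k = 0")
      case False
      then have "ln (a k / H) \<le> real k * \<rho>" using lo[of k] by (simp add: d_def field_simps)
      then have "exp (ln (a k / H)) \<le> exp (real k * \<rho>)" by simp
      then show ?thesis using Hp pos[of k] by (simp add: exp_of_nat_mult[symmetric] field_simps)
    qed (use H \<open>a 0 = 1\<close> in simp)
  qed
qed

text \<open>The constant enters only through \<open>K powr (1 / k)\<close> and its inverse, which
  tend to 1.\<close>

lemma root_limit_of_geometric_bounds:
  fixes a :: "nat \<Rightarrow> real"
  assumes r: "r > 0" and K: "K > 0"
    and lower: "\<And>k. r ^ k \<le> K * a k" and upper: "\<And>k. a k \<le> K * r ^ k"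
  shows "(\<lambda>k. a k powr (1 / real k)) \<longlonglongrightarrow> r"
proof (rule tendsto_sandwich)
  have e: "(\<lambda>k. 1 / real k) \<longlonglongrightarrow> 0" by (rule lim_const_over_n)
  have pow: "(r ^ k) powr (1 / real k) = r" if "k \<ge> 1" for k
    using that r by (simp add: powr_realpow[symmetric] powr_powr)
  have "(\<lambda>k. (1 / K) powr (1 / real k) * r) \<longlonglongrightarrow> (1 / K) powr 0 * r"
    using K by (intro tendsto_intros e) auto
  then show "(\<lambda>k. (1 / K) powr (1 / real k) * r) \<longlonglongrightarrow> r" using K by simp
  have "(\<lambda>k. K powr (1 / real k) * r) \<longlonglongrightarrow> K powr 0 * r"
    using K by (intro tendsto_intros e) auto
  then show "(\<lambda>k. K powr (1 / real k) * r) \<longlonglongrightarrow> r" using K by simp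
  show "\<forall>\<^sub>F k in sequentially. (1 / K) powr (1 / real k) * r \<le> a k powr (1 / real k)"
    using eventually_ge_at_top[of 1]
  proof eventually_elim
    case (elim k)
    have "((1 / K) * r ^ k) powr (1 / real k) \<le> a k powr (1 / real k)"
      using lower[of k] K r by (intro powr_mono2) (auto simp: field_simps)
    then show ?case using pow[OF elim] K r powr_mult[of "1 / K" "r ^ k" "1 / real k"] by simp
  qed
  show "\<forall>\<^sub>F k in sequentially. a k powr (1 / real k) \<le> K powr (1 / real k) * r"
    using eventually_ge_at_top[of 1]
  proof eventually_elim
    case (elim k)
    have "0 \<le> K * a k" using lower[of k] r by (meson less_imp_le order_trans zero_less_power)
    then have "0 \<le> a k" using K by (simp add: zero_le_mult_iff)
    then have "a k powr (1 / real k) \<le> (K * r ^ k) powr (1 / real k)"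
      using upper[of k] by (intro powr_mono2) auto
    then show ?case using pow[OF elim] K r powr_mult[of K "r ^ k" "1 / real k"] by simp
  qed
qed

subsection \<open>Iterated directional derivatives of the kernel\<close>

definition kern :: "real \<Rightarrow> complex \<Rightarrow> real" where
  "kern s \<zeta> = cmod \<zeta> powr (- 2 * s)"

lemma kern_nonneg [simp]: "kern s \<zeta> \<ge> 0"
  by (simp add: kern_def)

lemma kern_pos: "\<zeta> \<noteq> 0 \<Longrightarrow> kern s \<zeta> > 0"
  by (simp add: kern_def)

lemma kern_mult: "kern s (z * w) = kern s z * kern s w"
  by (simp add: kern_def norm_mult powr_mult)

text \<open>Algebra generated by the coordinates of \<open>1/\<zeta>\<close>; \<open>kern s\<close> times this algebra
  is closed under directional derivatives.\<close>

inductive recip_poly :: "(complex \<Rightarrow> real) \<Rightarrow> bool" where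
  const: "recip_poly (\<lambda>_. c)"
| re: "recip_poly (\<lambda>\<zeta>. Re (inverse \<zeta>))"
| im: "recip_poly (\<lambda>\<zeta>. Im (inverse \<zeta>))"
| add: "recip_poly f \<Longrightarrow> recip_poly g \<Longrightarrow> recip_poly (\<lambda>\<zeta>. f \<zeta> + g \<zeta>)"
| mult: "recip_poly f \<Longrightarrow> recip_poly g \<Longrightarrow> recip_poly (\<lambda>\<zeta>. f \<zeta> * g \<zeta>)"

lemma inverse_has_vector_derivative_line:
  assumes "\<zeta> \<noteq> (0::complex)"
  shows "((\<lambda>t::real. inverse (\<zeta> + of_real t * d)) has_vector_derivative
    - (d * (inverse \<zeta>)^2)) (at 0)"
proof -
  have "((\<lambda>t::real. \<zeta> + of_real t * d) has_vector_derivative d) (at 0)"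
    by (auto intro!: derivative_eq_intros simp: scaleR_conv_of_real)
  moreover have "(inverse has_field_derivative - (inverse \<zeta> ^ 2)) (at (\<zeta> + of_real (0::real) * d))"
    using DERIV_inverse[of \<zeta> UNIV] assms by (simp add: power2_eq_square)
  ultimately show ?thesis
    using field_vector_diff_chain_at[of "\<lambda>t. \<zeta> + of_real t * d" d 0 inverse "- (inverse \<zeta> ^ 2)"]
    by (simp add: o_def mult.commute)
qed

lemma Re_inverse_has_real_derivative:
  assumes "\<zeta> \<noteq> (0::complex)"
  shows "((\<lambda>t::real. Re (inverse (\<zeta> + of_real t * d))) has_real_derivative
    - Re (d * (inverse \<zeta>)^2)) (at 0)"
  using bounded_linear.has_vector_derivative[OF bounded_linear_Re
      inverse_has_vector_derivative_line[OF assms, of d]]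
  by (simp add: has_real_derivative_iff_has_vector_derivative)

lemma Im_inverse_has_real_derivative:
  assumes "\<zeta> \<noteq> (0::complex)"
  shows "((\<lambda>t::real. Im (inverse (\<zeta> + of_real t * d))) has_real_derivative
    - Im (d * (inverse \<zeta>)^2)) (at 0)"
  using bounded_linear.has_vector_derivative[OF bounded_linear_Im
      inverse_has_vector_derivative_line[OF assms, of d]]
  by (simp add: has_real_derivative_iff_has_vector_derivative)

text \<open>The derivative of \<open>1/\<zeta>\<close> in direction \<open>d\<close> is
  \<open>-d/\<zeta>^2\<close>, whose real and imaginary parts are quadratic in the coordinates of
  \<open>1/\<zeta>\<close>; the Leibniz rule does the rest.\<close>

lemma recip_poly_has_derivative:
  assumes "recip_poly h"
  shows "\<exists>h'. recip_poly h' \<and> (\<forall>\<zeta>. \<zeta> \<noteq> 0 \<longrightarrow>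
    ((\<lambda>t::real. h (\<zeta> + of_real t * d)) has_real_derivative h' \<zeta>) (at 0))"
  using assms
proof induction
  case (const c)
  show ?case using recip_poly.const[of 0] by (auto intro!: exI[of _ "\<lambda>_. 0"])
next
  case re
  let ?h = "\<lambda>\<zeta>. (- Re d) * (Re (inverse \<zeta>) * Re (inverse \<zeta>) + (-1) * (Im (inverse \<zeta>) * Im (inverse \<zeta>)))
    + 2 * Im d * (Re (inverse \<zeta>) * Im (inverse \<zeta>))"
  have "- Re (d * (inverse \<zeta>)^2) = ?h \<zeta>" for \<zeta>
    by (simp add: power2_eq_square algebra_simps del: inverse_complex.sel)
  with Re_inverse_has_real_derivative[of _ d] have "\<zeta> \<noteq> 0 \<Longrightarrow>
    ((\<lambda>t. Re (inverse (\<zeta> + of_real t * d))) has_real_derivative ?h \<zeta>) (at 0)" for \<zeta>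
    by (rule DERIV_cong)
  moreover have "recip_poly ?h" by (intro recip_poly.intros)
  ultimately show ?case by blast
next
  case im
  let ?h = "\<lambda>\<zeta>. (- Im d) * (Re (inverse \<zeta>) * Re (inverse \<zeta>) + (-1) * (Im (inverse \<zeta>) * Im (inverse \<zeta>)))
    + (- 2 * Re d) * (Re (inverse \<zeta>) * Im (inverse \<zeta>))"
  have "- Im (d * (inverse \<zeta>)^2) = ?h \<zeta>" for \<zeta>
    by (simp add: power2_eq_square algebra_simps del: inverse_complex.sel)
  with Im_inverse_has_real_derivative[of _ d] have "\<zeta> \<noteq> 0 \<Longrightarrow>
    ((\<lambda>t. Im (inverse (\<zeta> + of_real t * d))) has_real_derivative ?h \<zeta>) (at 0)" for \<zeta>
    by (rule DERIV_cong)
  moreover have "recip_poly ?h" by (intro recip_poly.intros)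
  ultimately show ?case by blast
next
  case (add f g)
  then obtain f' g' where "recip_poly f'" "recip_poly g'"
    "\<forall>\<zeta>. \<zeta> \<noteq> 0 \<longrightarrow> ((\<lambda>t. f (\<zeta> + of_real t * d)) has_real_derivative f' \<zeta>) (at 0)"
    "\<forall>\<zeta>. \<zeta> \<noteq> 0 \<longrightarrow> ((\<lambda>t. g (\<zeta> + of_real t * d)) has_real_derivative g' \<zeta>) (at 0)" by blast
  then show ?case
    by (intro exI[of _ "\<lambda>\<zeta>. f' \<zeta> + g' \<zeta>"] conjI recip_poly.add) (auto intro: DERIV_add)
next
  case (mult f g)
  then obtain f' g' where h: "recip_poly f'" "recip_poly g'"
    "\<forall>\<zeta>. \<zeta> \<noteq> 0 \<longrightarrow> ((\<lambda>t. f (\<zeta> + of_real t * d)) has_real_derivative f' \<zeta>) (at 0)"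
    "\<forall>\<zeta>. \<zeta> \<noteq> 0 \<longrightarrow> ((\<lambda>t. g (\<zeta> + of_real t * d)) has_real_derivative g' \<zeta>) (at 0)" by blast
  have "((\<lambda>t. f (\<zeta> + of_real t * d) * g (\<zeta> + of_real t * d))
      has_real_derivative f' \<zeta> * g \<zeta> + g' \<zeta> * f \<zeta>) (at 0)" if "\<zeta> \<noteq> 0" for \<zeta>
    using DERIV_mult[OF h(3)[rule_format, OF that] h(4)[rule_format, OF that]] by simp
  with h mult show ?case
    by (intro exI[of _ "\<lambda>\<zeta>. f' \<zeta> * g \<zeta> + g' \<zeta> * f \<zeta>"] conjI recip_poly.add recip_poly.mult) auto
qed

text \<open>Here \<open>1/\<zeta>\<close> has modulus at most 2. The half-plane
  \<open>Re \<zeta> > 1/2\<close> is where the arguments \<open>z + \<beta>\<close> lie for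
  \<open>z\<close> in the domain \<open>hp\<close> introduced below and
  \<open>Re \<beta> \<ge> \<gamma> \<ge> 1\<close>.\<close>

lemma recip_poly_bounded:
  assumes "recip_poly h"
  shows "\<exists>C\<ge>0. \<forall>\<zeta>. Re \<zeta> > 1/2 \<longrightarrow> \<bar>h \<zeta>\<bar> \<le> C"
  using assms
proof induction
  case (const c)
  show ?case by (auto intro!: exI[of _ "\<bar>c\<bar>"])
next
  case re
  have "\<bar>Re (inverse \<zeta>)\<bar> \<le> 2" if "Re \<zeta> > 1/2" for \<zeta>
  proof -
    have "cmod \<zeta> \<ge> 1/2" using that complex_Re_le_cmod[of \<zeta>] by linarith
    then have "inverse (cmod \<zeta>) \<le> inverse (1/2)" by (intro le_imp_inverse_le) auto
    then show ?thesis using abs_Re_le_cmod[of "inverse \<zeta>"] by (simp add: norm_inverse del: inverse_complex.sel)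
  qed
  then show ?case by (intro exI[of _ 2]) auto
next
  case im
  have "\<bar>Im (inverse \<zeta>)\<bar> \<le> 2" if "Re \<zeta> > 1/2" for \<zeta>
  proof -
    have "cmod \<zeta> \<ge> 1/2" using that complex_Re_le_cmod[of \<zeta>] by linarith
    then have "inverse (cmod \<zeta>) \<le> inverse (1/2)" by (intro le_imp_inverse_le) auto
    then show ?thesis using abs_Im_le_cmod[of "inverse \<zeta>"] by (simp add: norm_inverse del: inverse_complex.sel)
  qed
  then show ?case by (intro exI[of _ 2]) auto
next
  case (add f g)
  then obtain C D where "C \<ge> 0" "D \<ge> 0" "\<forall>\<zeta>. Re \<zeta> > 1/2 \<longrightarrow> \<bar>f \<zeta>\<bar> \<le> C"
    "\<forall>\<zeta>. Re \<zeta> > 1/2 \<longrightarrow> \<bar>g \<zeta>\<bar> \<le> D" by blast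
  then show ?case by (intro exI[of _ "C + D"]) (auto intro: order_trans[OF abs_triangle_ineq add_mono])
next
  case (mult f g)
  then obtain C D where "C \<ge> 0" "D \<ge> 0" "\<forall>\<zeta>. Re \<zeta> > 1/2 \<longrightarrow> \<bar>f \<zeta>\<bar> \<le> C"
    "\<forall>\<zeta>. Re \<zeta> > 1/2 \<longrightarrow> \<bar>g \<zeta>\<bar> \<le> D" by blast
  then show ?case by (intro exI[of _ "C * D"]) (auto simp: abs_mult intro: mult_mono)
qed

lemma kern_has_real_derivative:
  assumes "\<zeta> \<noteq> 0"
  shows "((\<lambda>t::real. kern s (\<zeta> + of_real t * d)) has_real_derivative
    - 2 * s * Re (d * inverse \<zeta>) * kern s \<zeta>) (at 0)"
proof -
  let ?n = "\<lambda>t::real. (Re \<zeta> + t * Re d)^2 + (Im \<zeta> + t * Im d)^2"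
  have k: "kern s (\<zeta> + of_real t * d) = ?n t powr (- s)" for t
    by (simp add: kern_def cmod_def powr_half_sqrt[symmetric] powr_powr)
  have n0: "(Re \<zeta>)\<^sup>2 + (Im \<zeta>)\<^sup>2 > 0" using assms
    by (metis complex_eq_iff sum_power2_gt_zero_iff zero_complex.sel)
  have "((\<lambda>t. ?n t powr (- s)) has_real_derivative
     - s * ((Re \<zeta>)\<^sup>2 + (Im \<zeta>)\<^sup>2) powr (- s - 1) * (2 * (Re \<zeta> * Re d + Im \<zeta> * Im d))) (at 0)"
    using n0 by (auto intro!: derivative_eq_intros simp: algebra_simps)
  moreover have "((Re \<zeta>)\<^sup>2 + (Im \<zeta>)\<^sup>2) powr (- s - 1) = kern s \<zeta> / ((Re \<zeta>)\<^sup>2 + (Im \<zeta>)\<^sup>2)"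
    using n0 k[of 0] by (simp add: powr_diff)
  moreover have "Re (d * inverse \<zeta>) = (Re \<zeta> * Re d + Im \<zeta> * Im d) / ((Re \<zeta>)\<^sup>2 + (Im \<zeta>)\<^sup>2)"
    by (simp add: add_divide_distrib mult.commute)
  ultimately show ?thesis unfolding k by (simp add: mult_ac)
qed

lemma eventually_shift_in_open:
  fixes z d :: complex
  assumes "open S" "z \<in> S"
  shows "eventually (\<lambda>t::real. z + of_real t * d \<in> S) (nhds 0)"
proof -
  have "open ((\<lambda>t::real. z + of_real t * d) -` S)"
    using assms by (intro open_vimage continuous_intros)
  from eventually_nhds_in_open[OF this, of 0] assms(2) show ?thesis by simp
qed

lemma pdir_cong:
  assumes "open S" "z \<in> S" "\<And>u. u \<in> S \<Longrightarrow> f u = g u"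
  shows "pdir d f z = pdir d g z"
  unfolding pdir_def
  by (rule deriv_cong_ev[OF eventually_mono[OF eventually_shift_in_open[OF assms(1,2), of d]]])
    (auto simp: assms(3))

lemma pder_cong:
  assumes "open S" "\<And>u. u \<in> S \<Longrightarrow> f u = g u" "z \<in> S"
  shows "pder ds f z = pder ds g z"
  using assms(3)
proof (induction ds arbitrary: z)
  case (Cons d ds)
  show ?case unfolding pder.simps by (rule pdir_cong[OF assms(1) Cons.prems Cons.IH])
qed (simp add: assms(2))

lemma has_real_derivative_line_cong:
  fixes z d :: complex
  assumes "open S" "z \<in> S" "\<And>u. u \<in> S \<Longrightarrow> f u = g u"
    and "((\<lambda>t::real. f (z + of_real t * d)) has_real_derivative D) (at 0)"
  shows "((\<lambda>t::real. g (z + of_real t * d)) has_real_derivative D) (at 0)"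
proof -
  have "eventually (\<lambda>t::real. f (z + of_real t * d) = g (z + of_real t * d)) (nhds 0)"
    by (rule eventually_mono[OF eventually_shift_in_open[OF assms(1,2), of d]]) (simp add: assms(3))
  from DERIV_cong_ev[OF refl this refl] assms(4) show ?thesis by simp
qed

lemma pdir_eqI:
  "((\<lambda>t::real. f (z + of_real t * d)) has_real_derivative D) (at 0) \<Longrightarrow> pdir d f z = D"
  by (simp add: pdir_def DERIV_imp_deriv)

lemma pder_translate: "pder ds (\<lambda>z. f (z + \<beta>)) z = pder ds f (z + \<beta>)"
proof (induction ds arbitrary: z)
  case (Cons d ds)
  have "z + of_real t * d + \<beta> = z + \<beta> + of_real t * d" for t :: real by simp
  then show ?case by (simp only: pder.simps pdir_def Cons.IH)
qed simp

lemma open_nonzero: "open (- {0::complex})" by (simp add: open_Compl)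

text \<open>The product formula and the existence of the next derivative are proved together:
  \<open>pder\<close> is built from \<open>deriv\<close>, which carries information only once
  differentiability is known.\<close>

lemma pder_kern:
  "\<exists>h. recip_poly h \<and> (\<forall>\<zeta>. \<zeta> \<noteq> 0 \<longrightarrow> pder ds (kern s) \<zeta> = kern s \<zeta> * h \<zeta>
    \<and> ((\<lambda>t::real. pder ds (kern s) (\<zeta> + of_real t * d)) has_real_derivative
        pder (d # ds) (kern s) \<zeta>) (at 0))"
proof (induction ds arbitrary: d)
  \<comment> \<open>The logarithmic derivative of the kernel in direction \<open>d\<close> is
    \<open>-2 s Re (d/\<zeta>)\<close>, again linear in the coordinates of \<open>1/\<zeta>\<close>,
    so the kernel factors out of the product rule.\<close>
  have step: "\<exists>h'. recip_poly h' \<and> (\<forall>\<zeta>. \<zeta> \<noteq> 0 \<longrightarrow>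
    ((\<lambda>t::real. g (\<zeta> + of_real t * d)) has_real_derivative kern s \<zeta> * h' \<zeta>) (at 0))"
    if h: "recip_poly h" and g: "\<And>\<zeta>. \<zeta> \<noteq> 0 \<Longrightarrow> g \<zeta> = kern s \<zeta> * h \<zeta>" for g h d
  proof -
    obtain h' where h': "recip_poly h'" "\<And>\<zeta>. \<zeta> \<noteq> 0 \<Longrightarrow>
      ((\<lambda>t::real. h (\<zeta> + of_real t * d)) has_real_derivative h' \<zeta>) (at 0)"
      using recip_poly_has_derivative[OF h, of d] by blast
    let ?k = "\<lambda>\<zeta>. (- 2 * s * Re d) * Re (inverse \<zeta>) + (2 * s * Im d) * Im (inverse \<zeta>)"
    let ?h = "\<lambda>\<zeta>. ?k \<zeta> * h \<zeta> + h' \<zeta>"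
    have "((\<lambda>t::real. g (\<zeta> + of_real t * d)) has_real_derivative kern s \<zeta> * ?h \<zeta>) (at 0)"
      if "\<zeta> \<noteq> 0" for \<zeta>
    proof (rule has_real_derivative_line_cong[OF open_nonzero])
      have "((\<lambda>t::real. kern s (\<zeta> + of_real t * d) * h (\<zeta> + of_real t * d)) has_real_derivative
        (- 2 * s * Re (d * inverse \<zeta>) * kern s \<zeta>) * h \<zeta> + h' \<zeta> * kern s \<zeta>) (at 0)"
        using DERIV_mult[OF kern_has_real_derivative[OF that, of s d] h'(2)[OF that]] by simp
      moreover have "(- 2 * s * Re (d * inverse \<zeta>) * kern s \<zeta>) * h \<zeta> + h' \<zeta> * kern s \<zeta> = kern s \<zeta> * ?h \<zeta>"
        by (simp add: algebra_simps del: inverse_complex.sel)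
      ultimately show "((\<lambda>t::real. kern s (\<zeta> + of_real t * d) * h (\<zeta> + of_real t * d))
        has_real_derivative kern s \<zeta> * ?h \<zeta>) (at 0)" by simp
      show "kern s u * h u = g u" if "u \<in> - {0}" for u using g[of u] that by simp
    qed (use that in simp)
    moreover have "recip_poly ?h" by (intro recip_poly.intros h h')
    ultimately show ?thesis by blast
  qed
  {
    case Nil
    have "\<And>\<zeta>. pder [] (kern s) \<zeta> = kern s \<zeta> * 1" by simp
    then obtain h' where h': "\<And>\<zeta>. \<zeta> \<noteq> 0 \<Longrightarrow>
      ((\<lambda>t::real. pder [] (kern s) (\<zeta> + of_real t * d)) has_real_derivative kern s \<zeta> * h' \<zeta>) (at 0)"
      using step[OF recip_poly.const[of 1], of "pder [] (kern s)" d] by blast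
    have "pder [d] (kern s) \<zeta> = kern s \<zeta> * h' \<zeta>" if "\<zeta> \<noteq> 0" for \<zeta>
      using pdir_eqI[OF h'[OF that]] by simp
    with h' recip_poly.const[of 1] show ?case by (intro exI[of _ "\<lambda>_. 1"]) (simp del: pder.simps(2))
  next
    case (Cons e ds)
    obtain h where h: "recip_poly h" "\<And>\<zeta>. \<zeta> \<noteq> 0 \<Longrightarrow> pder ds (kern s) \<zeta> = kern s \<zeta> * h \<zeta>"
      using Cons by blast
    obtain k where k: "recip_poly k" "\<And>\<zeta>. \<zeta> \<noteq> 0 \<Longrightarrow>
      ((\<lambda>t::real. pder ds (kern s) (\<zeta> + of_real t * e)) has_real_derivative kern s \<zeta> * k \<zeta>) (at 0)"
      using step[OF h] by blast
    have ke: "pder (e # ds) (kern s) \<zeta> = kern s \<zeta> * k \<zeta>" if "\<zeta> \<noteq> 0" for \<zeta>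
      using pdir_eqI[OF k(2)[OF that]] by simp
    obtain l where l: "\<And>\<zeta>. \<zeta> \<noteq> 0 \<Longrightarrow>
      ((\<lambda>t::real. pder (e # ds) (kern s) (\<zeta> + of_real t * d)) has_real_derivative kern s \<zeta> * l \<zeta>) (at 0)"
      using step[OF k(1) ke] by blast
    have "pder (d # e # ds) (kern s) \<zeta> = kern s \<zeta> * l \<zeta>" if "\<zeta> \<noteq> 0" for \<zeta>
      using pdir_eqI[OF l[OF that]] by simp
    with k(1) ke l show ?case by (intro exI[of _ k]) (simp del: pder.simps)
  }
qed

lemma pder_kern_has_real_derivative:
  "\<zeta> \<noteq> 0 \<Longrightarrow> ((\<lambda>t::real. pder ds (kern s) (\<zeta> + of_real t * d)) has_real_derivative
        pder (d # ds) (kern s) \<zeta>) (at 0)"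
  using pder_kern by blast

text \<open>The bound is relative to the kernel, not absolute; only in this form is it a linear
  inequality that sums of kernels inherit with the same constant.\<close>

lemma pder_kern_bound:
  "\<exists>C\<ge>0. \<forall>\<zeta>. Re \<zeta> > 1/2 \<longrightarrow> \<bar>pder ds (kern s) \<zeta>\<bar> \<le> C * kern s \<zeta>"
proof -
  obtain h where h: "recip_poly h" "\<And>\<zeta>. \<zeta> \<noteq> 0 \<Longrightarrow> pder ds (kern s) \<zeta> = kern s \<zeta> * h \<zeta>"
    using pder_kern by blast
  obtain C where C: "C \<ge> 0" "\<And>\<zeta>. Re \<zeta> > 1/2 \<Longrightarrow> \<bar>h \<zeta>\<bar> \<le> C" using recip_poly_bounded[OF h(1)] by blast
  have "\<bar>pder ds (kern s) \<zeta>\<bar> \<le> C * kern s \<zeta>" if "Re \<zeta> > 1/2" for \<zeta>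
  proof -
    have "\<zeta> \<noteq> 0" using that by auto
    then have "pder ds (kern s) \<zeta> = kern s \<zeta> * h \<zeta>" by (rule h(2))
    then show ?thesis using mult_left_mono[OF C(2)[OF that], of "kern s \<zeta>"]
      by (simp add: abs_mult mult.commute)
  qed
  then show ?thesis using C(1) by blast
qed

section \<open>Explicit second-derivative bounds for the kernel\<close>

lemma pder_kern_xx:
  assumes "\<zeta> \<noteq> 0"
  shows "pder [1, 1] (kern s) \<zeta> =
    2 * s * ((2 * s + 1) * (Re (inverse \<zeta>))^2 - (Im (inverse \<zeta>))^2) * kern s \<zeta>"
proof -
  have 1: "pder [1] (kern s) u = - 2 * s * Re (inverse u) * kern s u" if "u \<noteq> 0" for u
    using pdir_eqI[OF kern_has_real_derivative[OF that, of s 1]] by simp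
  have "((\<lambda>t::real. - 2 * s * Re (inverse (\<zeta> + of_real t * 1)) * kern s (\<zeta> + of_real t * 1))
    has_real_derivative 2 * s * ((2 * s + 1) * (Re (inverse \<zeta>))^2 - (Im (inverse \<zeta>))^2) * kern s \<zeta>) (at 0)"
    using DERIV_mult[OF DERIV_cmult[OF Re_inverse_has_real_derivative[OF assms, of 1], of "- 2 * s"]
        kern_has_real_derivative[OF assms, of s 1]]
    by (rule DERIV_cong) (simp add: power2_eq_square algebra_simps del: inverse_complex.sel)
  then have "pdir 1 (pder [1] (kern s)) \<zeta> =
     2 * s * ((2 * s + 1) * (Re (inverse \<zeta>))^2 - (Im (inverse \<zeta>))^2) * kern s \<zeta>"
    by (rule pdir_eqI[OF has_real_derivative_line_cong[OF open_nonzero, of \<zeta>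
          "\<lambda>u. - 2 * s * Re (inverse u) * kern s u", rotated 2]])
      (use assms 1 in \<open>simp_all del: pder.simps inverse_complex.sel\<close>)
  then show ?thesis by simp
qed

lemma pder_kern_yy:
  assumes "\<zeta> \<noteq> 0"
  shows "pder [\<i>, \<i>] (kern s) \<zeta> =
    2 * s * ((2 * s + 1) * (Im (inverse \<zeta>))^2 - (Re (inverse \<zeta>))^2) * kern s \<zeta>"
proof -
  have 1: "pder [\<i>] (kern s) u = 2 * s * Im (inverse u) * kern s u" if "u \<noteq> 0" for u
    using pdir_eqI[OF kern_has_real_derivative[OF that, of s \<i>]] by simp
  have "((\<lambda>t::real. 2 * s * Im (inverse (\<zeta> + of_real t * \<i>)) * kern s (\<zeta> + of_real t * \<i>))
    has_real_derivative 2 * s * ((2 * s + 1) * (Im (inverse \<zeta>))^2 - (Re (inverse \<zeta>))^2) * kern s \<zeta>) (at 0)"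
    using DERIV_mult[OF DERIV_cmult[OF Im_inverse_has_real_derivative[OF assms, of \<i>], of "2 * s"]
        kern_has_real_derivative[OF assms, of s \<i>]]
    by (rule DERIV_cong) (simp add: power2_eq_square algebra_simps del: inverse_complex.sel)
  then have "pdir \<i> (pder [\<i>] (kern s)) \<zeta> =
     2 * s * ((2 * s + 1) * (Im (inverse \<zeta>))^2 - (Re (inverse \<zeta>))^2) * kern s \<zeta>"
    by (rule pdir_eqI[OF has_real_derivative_line_cong[OF open_nonzero, of \<zeta>
          "\<lambda>u. 2 * s * Im (inverse u) * kern s u", rotated 2]])
      (use assms 1 in \<open>simp_all del: pder.simps inverse_complex.sel\<close>)
  then show ?thesis by simp
qed

lemma disk_Re_bounds:
  fixes a b g :: real
  assumes "g > 0" "a^2 + b^2 \<le> a * g"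
  shows "0 \<le> a" "a \<le> g"
proof -
  have aa: "a * a \<le> a * g" using assms(2) zero_le_power2[of b] unfolding power2_eq_square by linarith
  show a: "0 \<le> a"
  proof (rule ccontr)
    assume "\<not> 0 \<le> a"
    then have "a * g < 0" using assms(1) by (simp add: mult_neg_pos)
    then show False using aa zero_le_square[of a] by linarith
  qed
  show "a \<le> g" using aa a assms(1) by (cases "a = 0") auto
qed

text \<open>This is the image of the half-plane \<open>Re \<zeta> \<ge> \<gamma>\<close> under
  inversion followed by reflection: the disk with diameter \<open>[0, 1/\<gamma>]\<close>.\<close>

lemma inverse_in_disk:
  assumes "\<gamma> > 0" "Re \<zeta> \<ge> \<gamma>"
  shows "(Re (inverse \<zeta>))^2 + (Im (inverse \<zeta>))^2 \<le> Re (inverse \<zeta>) / \<gamma>"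
proof -
  have n: "(Re \<zeta>)\<^sup>2 + (Im \<zeta>)\<^sup>2 > 0" using assms by (simp add: sum_power2_gt_zero_iff)
  have "(Re (inverse \<zeta>))^2 + (Im (inverse \<zeta>))^2 = 1 / ((Re \<zeta>)\<^sup>2 + (Im \<zeta>)\<^sup>2)"
    using n by (simp add: power_divide add_divide_distrib[symmetric] power2_eq_square)
  also have "\<dots> \<le> (Re \<zeta> / \<gamma>) * (1 / ((Re \<zeta>)\<^sup>2 + (Im \<zeta>)\<^sup>2))"
    using assms n mult_right_mono[of 1 "Re \<zeta> / \<gamma>" "1 / ((Re \<zeta>)\<^sup>2 + (Im \<zeta>)\<^sup>2)"] by simp
  also have "\<dots> = Re (inverse \<zeta>) / \<gamma>" by simp
  finally show ?thesis .
qed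

lemma pder_kern_xx_bounds:
  assumes "\<gamma> > 0" "Re \<zeta> \<ge> \<gamma>" "s \<ge> 0"
  shows "- (s / (4 * \<gamma>^2 * (s + 1))) * kern s \<zeta> \<le> pder [1, 1] (kern s) \<zeta>"
    and "pder [1, 1] (kern s) \<zeta> \<le> (2 * s * (2 * s + 1) / \<gamma>^2) * kern s \<zeta>"
proof -
  define a b g where "a = Re (inverse \<zeta>)" and "b = Im (inverse \<zeta>)" and "g = 1 / \<gamma>"
  have ab: "a^2 + b^2 \<le> a * g" using inverse_in_disk[OF assms(1,2)] by (simp add: a_def b_def g_def)
  have g: "g > 0" using assms by (simp add: g_def)
  have z: "\<zeta> \<noteq> 0" using assms by auto
  note a0 = disk_Re_bounds(1)[OF g ab] and ag = disk_Re_bounds(2)[OF g ab]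
  \<comment> \<open>On the disk \<open>b^2 \<le> a g - a^2\<close>, so the form is at least
    \<open>2 (s + 1) a^2 - a g\<close>. The square vanishes at the minimum
    \<open>a = g / (4 (s + 1))\<close>, where this equals \<open>-g^2 / (8 (s + 1))\<close>.\<close>
  have "0 \<le> (4 * (s + 1) * a - g)^2" by simp
  moreover have "8 * (s + 1) * b^2 \<le> 8 * (s + 1) * (a * g - a^2)"
    using ab assms(3) by (intro mult_left_mono) auto
  ultimately have "8 * (s + 1) * (b^2 - (2 * s + 1) * a^2) \<le> g^2"
    by (simp add: power2_eq_square algebra_simps)
  then have "(- (g^2)) / (8 * (s + 1)) \<le> (2 * s + 1) * a^2 - b^2"
    using assms(3) by (simp add: field_simps)
  then have "2 * s * ((- (g^2)) / (8 * (s + 1))) \<le> 2 * s * ((2 * s + 1) * a^2 - b^2)"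
    using assms(3) by (intro mult_left_mono) auto
  moreover have "2 * s * ((- (g^2)) / (8 * (s + 1))) = - (s / (4 * \<gamma>^2 * (s + 1)))"
  proof -
    have "2 * s * (- x / (2 * (4 * y))) = - (s * x / (4 * y))" for x y :: real by simp
    from this[of "g^2" "s + 1"] show ?thesis by (simp add: g_def power_divide mult_ac)
  qed
  ultimately have lo: "- (s / (4 * \<gamma>^2 * (s + 1))) \<le> 2 * s * ((2 * s + 1) * a^2 - b^2)" by simp
  show "- (s / (4 * \<gamma>^2 * (s + 1))) * kern s \<zeta> \<le> pder [1, 1] (kern s) \<zeta>"
    unfolding pder_kern_xx[OF z] using lo unfolding a_def b_def by (rule mult_right_mono) simp
  have "a^2 \<le> g^2" using a0 ag by (simp add: power_mono)
  then have "(2 * s + 1) * a^2 - b^2 \<le> (2 * s + 1) * g^2"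
    using mult_left_mono[of "a^2" "g^2" "2 * s + 1"] zero_le_power2[of b] assms(3) by linarith
  then have "2 * s * ((2 * s + 1) * a^2 - b^2) \<le> 2 * s * ((2 * s + 1) * g^2)"
    using assms(3) by (intro mult_left_mono) auto
  also have "\<dots> = 2 * s * (2 * s + 1) / \<gamma>^2" by (simp add: g_def power_divide)
  finally show "pder [1, 1] (kern s) \<zeta> \<le> (2 * s * (2 * s + 1) / \<gamma>^2) * kern s \<zeta>"
    unfolding pder_kern_xx[OF z] a_def b_def by (rule mult_right_mono) simp
qed

lemma pder_kern_yy_bounds:
  assumes "\<gamma> > 0" "Re \<zeta> \<ge> \<gamma>" "s \<ge> 0"
  shows "- (2 * s / \<gamma>^2) * kern s \<zeta> \<le> pder [\<i>, \<i>] (kern s) \<zeta>"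
    and "pder [\<i>, \<i>] (kern s) \<zeta> \<le> (2 * s * (2 * s + 1) / (4 * \<gamma>^2)) * kern s \<zeta>"
proof -
  define a b g where "a = Re (inverse \<zeta>)" and "b = Im (inverse \<zeta>)" and "g = 1 / \<gamma>"
  have ab: "a^2 + b^2 \<le> a * g" using inverse_in_disk[OF assms(1,2)] by (simp add: a_def b_def g_def)
  have g: "g > 0" using assms by (simp add: g_def)
  have z: "\<zeta> \<noteq> 0" using assms by auto
  note a0 = disk_Re_bounds(1)[OF g ab] and ag = disk_Re_bounds(2)[OF g ab]
  have a2: "a^2 \<le> g^2" using a0 ag by (simp add: power_mono)
  moreover have "0 \<le> (2 * s + 1) * b^2" using assms(3) by simp
  ultimately have "2 * s * (- (g^2)) \<le> 2 * s * ((2 * s + 1) * b^2 - a^2)"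
    using assms(3) by (intro mult_left_mono) linarith+
  moreover have "2 * s * (- (g^2)) = - (2 * s / \<gamma>^2)" by (simp add: g_def power_divide)
  ultimately have lo: "- (2 * s / \<gamma>^2) \<le> 2 * s * ((2 * s + 1) * b^2 - a^2)" by simp
  show "- (2 * s / \<gamma>^2) * kern s \<zeta> \<le> pder [\<i>, \<i>] (kern s) \<zeta>"
    unfolding pder_kern_yy[OF z] using lo unfolding a_def b_def by (rule mult_right_mono) simp
  \<comment> \<open>\<open>a g - a^2\<close> is largest at \<open>a = g / 2\<close>: the disk has
    radius \<open>g / 2\<close>. This is the source of the 4 in the upper bound.\<close>
  have "0 \<le> (a - g / 2)^2" by simp
  then have "b^2 \<le> g^2 / 4" using ab by (simp add: power2_eq_square field_simps)
  then have "(2 * s + 1) * b^2 - a^2 \<le> (2 * s + 1) * (g^2 / 4)"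
    using mult_left_mono[of "b^2" "g^2 / 4" "2 * s + 1"] zero_le_power2[of a] assms(3) by linarith
  then have "2 * s * ((2 * s + 1) * b^2 - a^2) \<le> 2 * s * ((2 * s + 1) * (g^2 / 4))"
    using assms(3) by (intro mult_left_mono) auto
  also have "\<dots> = 2 * s * (2 * s + 1) / (4 * \<gamma>^2)" by (simp add: g_def power_divide)
  finally show "pder [\<i>, \<i>] (kern s) \<zeta> \<le> (2 * s * (2 * s + 1) / (4 * \<gamma>^2)) * kern s \<zeta>"
    unfolding pder_kern_yy[OF z] a_def b_def by (rule mult_right_mono) simp
qed

section \<open>Comparison of kernel values at two points\<close>

lemma kern_antimono:
  assumes "s \<ge> 0" "\<zeta>' \<noteq> 0" "cmod \<zeta>' \<le> cmod \<zeta>"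
  shows "kern s \<zeta> \<le> kern s \<zeta>'"
  unfolding kern_def using assms by (intro powr_mono2') auto

lemma kern_harnack:
  assumes s: "s \<ge> 0" and C: "C > 0" and nz: "\<zeta> \<noteq> 0" and le: "cmod \<zeta>' \<le> C * cmod \<zeta>"
    and "\<zeta>' \<noteq> 0"
  shows "kern s \<zeta> \<le> C powr (2 * s) * kern s \<zeta>'"
proof -
  have "(C * cmod \<zeta>) powr (- 2 * s) \<le> cmod \<zeta>' powr (- 2 * s)"
    using assms by (intro powr_mono2') auto
  then have "C powr (- 2 * s) * kern s \<zeta> \<le> kern s \<zeta>'"
    using C by (simp add: kern_def powr_mult)
  then show ?thesis using C by (simp add: powr_minus field_simps)
qed

text \<open>The derivative of \<open>ln (x^2 + y^2)\<close> in \<open>y\<close> is at most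
  \<open>1/x\<close> in modulus, by \<open>2 |y| x \<le> x^2 + y^2\<close>. This gains a factor 2
  over the estimate for arbitrary directions and yields \<open>s/\<gamma>\<close> in (iii).\<close>

lemma norm_vertical_shift:
  assumes "\<gamma> > 0" "x \<ge> \<gamma>"
  shows "cmod (Complex x y2) \<le> exp (\<bar>y1 - y2\<bar> / (2 * \<gamma>)) * cmod (Complex x y1)"
proof -
  have x: "x > 0" using assms by simp
  have pos: "x^2 + y^2 > 0" for y using x by (simp add: sum_power2_gt_zero_iff)
  have "\<bar>ln (x^2 + y2^2) - ln (x^2 + y1^2)\<bar> \<le> (1 / \<gamma>) * \<bar>y2 - y1\<bar>"
  proof -
    have "norm (ln (x^2 + y2^2) - ln (x^2 + y1^2)) \<le> (1 / \<gamma>) * norm (y2 - y1)"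
    proof (rule field_differentiable_bound[of UNIV _ "\<lambda>y. 2 * y / (x^2 + y^2)"])
      fix y :: real
      show "((\<lambda>y. ln (x^2 + y^2)) has_field_derivative 2 * y / (x^2 + y^2)) (at y within UNIV)"
        using pos[of y] by (auto intro!: derivative_eq_intros)
      have "2 * \<bar>y\<bar> * x \<le> x^2 + y^2"
        using sum_squares_bound[of "\<bar>y\<bar>" x] by (simp add: power2_eq_square)
      then have "2 * \<bar>y\<bar> / (x^2 + y^2) \<le> 1 / x" using pos[of y] x by (simp add: field_simps)
      also have "\<dots> \<le> 1 / \<gamma>" using assms by (simp add: frac_le)
      finally show "norm (2 * y / (x^2 + y^2)) \<le> 1 / \<gamma>" using pos[of y] by (simp add: abs_mult)
    qed auto
    then show ?thesis by simp
  qed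
  then have "ln (x^2 + y2^2) \<le> \<bar>y1 - y2\<bar> / \<gamma> + ln (x^2 + y1^2)"
    by (simp add: abs_minus_commute)
  then have "exp (ln (x^2 + y2^2)) \<le> exp (\<bar>y1 - y2\<bar> / \<gamma>) * exp (ln (x^2 + y1^2))"
    by (simp add: exp_add[symmetric] del: exp_ln)
  then have "x^2 + y2^2 \<le> exp (\<bar>y1 - y2\<bar> / \<gamma>) * (x^2 + y1^2)" using pos by simp
  moreover have "exp (\<bar>y1 - y2\<bar> / \<gamma>) = (exp (\<bar>y1 - y2\<bar> / (2 * \<gamma>)))^2"
    by (simp add: power2_eq_square exp_add[symmetric])
  ultimately have "(cmod (Complex x y2))^2 \<le> (exp (\<bar>y1 - y2\<bar> / (2 * \<gamma>)) * cmod (Complex x y1))^2"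
    by (simp add: cmod_power2 power_mult_distrib)
  then show ?thesis by (rule power2_le_imp_le) simp
qed

text \<open>The triangle inequality, made relative by \<open>cmod \<zeta> \<ge> \<gamma>\<close>,
  followed by \<open>1 + t \<le> exp t\<close>.\<close>

lemma norm_shift_exp:
  assumes "\<gamma> > 0" "Re \<zeta> \<ge> \<gamma>"
  shows "cmod \<zeta>' \<le> exp (cmod (\<zeta>' - \<zeta>) / \<gamma>) * cmod \<zeta>"
proof -
  have g: "\<gamma> \<le> cmod \<zeta>" using assms complex_Re_le_cmod[of \<zeta>] by linarith
  have "cmod \<zeta>' \<le> cmod \<zeta> + cmod (\<zeta>' - \<zeta>)" by (metis add.commute norm_triangle_sub)
  also have "\<dots> \<le> cmod \<zeta> + cmod (\<zeta>' - \<zeta>) / \<gamma> * cmod \<zeta>"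
    using g assms mult_left_mono[OF g, of "cmod (\<zeta>' - \<zeta>)"] by (simp add: field_simps)
  also have "\<dots> = (1 + cmod (\<zeta>' - \<zeta>) / \<gamma>) * cmod \<zeta>" by (simp add: algebra_simps)
  also have "\<dots> \<le> exp (cmod (\<zeta>' - \<zeta>) / \<gamma>) * cmod \<zeta>"
    by (intro mult_right_mono exp_ge_add_one_self) auto
  finally show ?thesis .
qed

subsection \<open>Functions smooth along lines\<close>

text \<open>Existence of all iterated directional derivatives, recorded separately because
  \<open>pder\<close> has a value even where no derivative exists; without it \<open>pder\<close> is
  not linear.\<close>

definition line_smooth :: "complex set \<Rightarrow> (complex \<Rightarrow> real) \<Rightarrow> bool" where
  "line_smooth S f \<longleftrightarrow> (\<forall>ds d. \<forall>z\<in>S.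
     ((\<lambda>t::real. pder ds f (z + of_real t * d)) has_real_derivative pder (d # ds) f z) (at 0))"

lemma line_smooth_cong:
  assumes "open S" "line_smooth S f" "\<And>u. u \<in> S \<Longrightarrow> f u = g u"
  shows "line_smooth S g"
  unfolding line_smooth_def
proof (intro allI ballI)
  fix ds d z assume z: "z \<in> S"
  have eq: "pder ds f u = pder ds g u" if "u \<in> S" for ds u
    by (rule pder_cong[OF assms(1) _ that]) (rule assms(3))
  have "((\<lambda>t::real. pder ds f (z + of_real t * d)) has_real_derivative pder (d # ds) g z) (at 0)"
    using assms(2) z eq[OF z, of "d # ds"] unfolding line_smooth_def by metis
  then show "((\<lambda>t::real. pder ds g (z + of_real t * d)) has_real_derivative pder (d # ds) g z) (at 0)"
    by (rule has_real_derivative_line_cong[OF assms(1) z, rotated]) (rule eq)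
qed

text \<open>The formula is established on all of the open set before the next differentiation, since
  a derivative at \<open>z\<close> depends on values near \<open>z\<close>.\<close>

lemma pder_add:
  assumes S: "open S" and f: "line_smooth S f" and g: "line_smooth S g"
  shows "z \<in> S \<Longrightarrow> pder ds (\<lambda>u. f u + g u) z = pder ds f z + pder ds g z"
    and "line_smooth S (\<lambda>u. f u + g u)"
proof -
  have step: "((\<lambda>t::real. pder ds (\<lambda>u. f u + g u) (z + of_real t * d)) has_real_derivative
      pder (d # ds) f z + pder (d # ds) g z) (at 0)"
    if eq: "\<And>z. z \<in> S \<Longrightarrow> pder ds (\<lambda>u. f u + g u) z = pder ds f z + pder ds g z" and z: "z \<in> S"
    for ds d z
  proof (rule has_real_derivative_line_cong[OF S z])
    show "pder ds f u + pder ds g u = pder ds (\<lambda>u. f u + g u) u" if "u \<in> S" for u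
      using eq[OF that] by simp
    show "((\<lambda>t::real. pder ds f (z + of_real t * d) + pder ds g (z + of_real t * d)) has_real_derivative
      pder (d # ds) f z + pder (d # ds) g z) (at 0)"
      using f g z unfolding line_smooth_def by (intro DERIV_add) blast+
  qed
  have eq: "pder ds (\<lambda>u. f u + g u) z = pder ds f z + pder ds g z" if "z \<in> S" for ds z
    using that
  proof (induction ds arbitrary: z)
    case (Cons d ds)
    show ?case using pdir_eqI[OF step[OF Cons.IH Cons.prems, of d]] by simp
  qed simp
  then show "z \<in> S \<Longrightarrow> pder ds (\<lambda>u. f u + g u) z = pder ds f z + pder ds g z" .
  show "line_smooth S (\<lambda>u. f u + g u)"
    unfolding line_smooth_def using step[OF eq] eq by (metis (no_types, lifting))
qed

lemma pder_cmult:
  assumes S: "open S" and f: "line_smooth S f"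
  shows "z \<in> S \<Longrightarrow> pder ds (\<lambda>u. c * f u) z = c * pder ds f z"
    and "line_smooth S (\<lambda>u. c * f u)"
proof -
  have step: "((\<lambda>t::real. pder ds (\<lambda>u. c * f u) (z + of_real t * d)) has_real_derivative
      c * pder (d # ds) f z) (at 0)"
    if eq: "\<And>z. z \<in> S \<Longrightarrow> pder ds (\<lambda>u. c * f u) z = c * pder ds f z" and z: "z \<in> S"
    for ds d z
  proof (rule has_real_derivative_line_cong[OF S z])
    show "c * pder ds f u = pder ds (\<lambda>u. c * f u) u" if "u \<in> S" for u
      using eq[OF that] by simp
    show "((\<lambda>t::real. c * pder ds f (z + of_real t * d)) has_real_derivative
      c * pder (d # ds) f z) (at 0)"
      using f z unfolding line_smooth_def by (intro DERIV_cmult) blast+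
  qed
  have eq: "pder ds (\<lambda>u. c * f u) z = c * pder ds f z" if "z \<in> S" for ds z
    using that
  proof (induction ds arbitrary: z)
    case (Cons d ds)
    show ?case using pdir_eqI[OF step[OF Cons.IH Cons.prems, of d]] by simp
  qed simp
  then show "z \<in> S \<Longrightarrow> pder ds (\<lambda>u. c * f u) z = c * pder ds f z" .
  show "line_smooth S (\<lambda>u. c * f u)"
    unfolding line_smooth_def using step[OF eq] eq by (metis (no_types, lifting))
qed

lemma pder_const: "pder ds (\<lambda>_. c) = (\<lambda>_. if ds = [] then c else 0)"
  by (induction ds) (auto simp: pdir_def fun_eq_iff)

lemma line_smooth_const: "line_smooth S (\<lambda>_. c)"
  unfolding line_smooth_def pder_const by simp

subsection \<open>The transfer operator and its invariant cone\<close>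

text \<open>An open neighbourhood of the closed right half-plane, so that derivatives exist up to the
  boundary of \<open>U\<close>; the branches map it into the right half-plane.\<close>

definition hp :: "complex set" where "hp = {z. Re z > -1/2}"

lemma mem_hp [simp]: "z \<in> hp \<longleftrightarrow> Re z > -1/2"
  by (simp add: hp_def)

lemma open_hp: "open hp"
  unfolding hp_def by (rule open_halfspace_Re_gt)

lemma Re_inverse_pos: "Re \<zeta> > 0 \<Longrightarrow> Re (1 / \<zeta>) > 0"
  by (simp add: Re_divide sum_power2_gt_zero_iff)

text \<open>\<open>A\<close> plays the role of \<open>\<B>_R\<close>. No domain is fixed: functions
  are total on the plane, and the closure of \<open>U\<close> enters later as a compact invariant
  set.\<close>

locale transfer_op =
  fixes A :: "complex set" and \<gamma> \<alpha> s :: real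
  assumes fin: "finite A" and A: "\<And>b. b \<in> A \<Longrightarrow> Re b \<ge> \<gamma>" and \<gamma>: "\<gamma> \<ge> 1"
    and \<alpha>: "\<alpha> \<ge> 0" and s: "s \<ge> 0" and nontriv: "\<alpha> > 0 \<or> A \<noteq> {}"
begin

definition T :: "(complex \<Rightarrow> real) \<Rightarrow> complex \<Rightarrow> real" where
  "T f z = (\<Sum>b\<in>A. kern s (z + b) * f (1 / (z + b))) + \<alpha> * f 0"

definition m :: "nat \<Rightarrow> complex \<Rightarrow> real" where
  "m k = (T ^^ k) (\<lambda>_. 1)"

text \<open>The clause \<open>agree\<close> is there because the kernel identity fails at the poles
  \<open>z = -b\<close>; these lie outside \<open>hp\<close>, and only values on \<open>hp\<close>
  matter.\<close>

inductive cone :: "(complex \<Rightarrow> real) \<Rightarrow> bool" where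
  const: "c \<ge> 0 \<Longrightarrow> cone (\<lambda>_. c)"
| atom: "c \<ge> 0 \<Longrightarrow> Re \<beta> \<ge> \<gamma> \<Longrightarrow> cone (\<lambda>z. c * kern s (z + \<beta>))"
| add: "cone f \<Longrightarrow> cone g \<Longrightarrow> cone (\<lambda>z. f z + g z)"
| agree: "cone f \<Longrightarrow> (\<And>z. z \<in> hp \<Longrightarrow> f z = g z) \<Longrightarrow> cone g"

lemma cone_sum: "finite I \<Longrightarrow> (\<And>i. i \<in> I \<Longrightarrow> cone (f i)) \<Longrightarrow> cone (\<lambda>z. \<Sum>i\<in>I. f i z)"
proof (induction I rule: finite_induct)
  case empty
  show ?case using cone.const[of 0] by simp
next
  case (insert i I)
  then show ?case using cone.add[of "f i" "\<lambda>z. \<Sum>i\<in>I. f i z"] by simp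
qed

lemma hp_shift: "z \<in> hp \<Longrightarrow> Re \<beta> \<ge> \<gamma> \<Longrightarrow> Re (z + \<beta>) > 1/2"
  using \<gamma> by simp

lemma hp_shift_nonzero: "z \<in> hp \<Longrightarrow> Re \<beta> \<ge> \<gamma> \<Longrightarrow> z + \<beta> \<noteq> 0"
  using hp_shift[of z \<beta>] by (metis less_irrefl zero_complex.sel(1) less_trans zero_less_divide_1_iff zero_less_numeral)

lemma branch_hp: "z \<in> hp \<Longrightarrow> b \<in> A \<Longrightarrow> 1 / (z + b) \<in> hp"
  using Re_inverse_pos[of "z + b"] hp_shift[of z b] A[of b] by simp

lemma cone_T: "cone f \<Longrightarrow> cone (T f)"
proof (induction rule: cone.induct)
  case (const c)
  have "cone (\<lambda>z. (\<Sum>b\<in>A. c * kern s (z + b)) + \<alpha> * c)"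
    using const \<alpha> A by (intro cone.add cone.const cone_sum fin cone.atom) auto
  then show ?case by (rule cone.agree) (simp add: T_def mult.commute)
next
  case (atom c \<beta>)
  have \<beta>: "\<beta> \<noteq> 0" "Re (1 / \<beta>) > 0" using atom \<gamma> Re_inverse_pos[of \<beta>] by auto
  have "cone (\<lambda>z. (\<Sum>b\<in>A. (c * kern s \<beta>) * kern s (z + (b + 1 / \<beta>))) + \<alpha> * (c * kern s (0 + \<beta>)))"
  proof (intro cone.add cone.const cone_sum fin cone.atom)
    \<comment> \<open>The new parameter stays admissible since \<open>1/\<beta>\<close> has positive
      real part.\<close>
    fix b assume "b \<in> A"
    then show "\<gamma> \<le> Re (b + 1 / \<beta>)" using A[of b] \<beta>(2) by simp
  qed (use atom \<alpha> in auto)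
  then show ?case
  proof (rule cone.agree)
    fix z assume z: "z \<in> hp"
    have "c * kern s \<beta> * kern s (z + (b + 1 / \<beta>)) = kern s (z + b) * (c * kern s (1 / (z + b) + \<beta>))"
      if b: "b \<in> A" for b
    proof -
      have "z + b \<noteq> 0" using hp_shift_nonzero[OF z] A[OF b] by blast
      \<comment> \<open>Both sides of the kernel identity are the kernel at this one number, because
        the kernel is multiplicative.\<close>
      then have "\<beta> * (z + (b + 1 / \<beta>)) = (z + b) * (1 / (z + b) + \<beta>)"
        using \<beta> by (simp add: field_simps)
      then show ?thesis by (metis kern_mult mult.assoc mult.left_commute)
    qed
    then show "(\<Sum>b\<in>A. (c * kern s \<beta>) * kern s (z + (b + 1 / \<beta>))) + \<alpha> * (c * kern s (0 + \<beta>))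
      = T (\<lambda>z. c * kern s (z + \<beta>)) z"
      unfolding T_def by (metis (no_types, lifting) sum.cong)
  qed
next
  case (add f g)
  have "T (\<lambda>z. f z + g z) = (\<lambda>z. T f z + T g z)"
    by (simp add: T_def fun_eq_iff sum.distrib distrib_left)
  with add show ?case by (simp add: cone.add)
next
  case (agree f g)
  show ?case
  proof (rule cone.agree[OF agree.IH])
    fix z assume z: "z \<in> hp"
    have "f (1 / (z + b)) = g (1 / (z + b))" if "b \<in> A" for b
      using agree.hyps(2)[OF branch_hp[OF z that]] .
    moreover have "f 0 = g 0" using agree.hyps(2)[of 0] by simp
    ultimately show "T f z = T g z" by (simp add: T_def)
  qed
qed

lemma cone_harnack:
  assumes "cone f" "z \<in> hp" "z' \<in> hp" "H \<ge> 1"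
    "\<And>\<beta>. Re \<beta> \<ge> \<gamma> \<Longrightarrow> kern s (z + \<beta>) \<le> H * kern s (z' + \<beta>)"
  shows "f z \<le> H * f z'"
  using assms(1)
proof (induction rule: cone.induct)
  case (const c)
  then show ?case using assms(4) by (simp add: mult_ge1_I mult_le_cancel_right1)
next
  case (atom c \<beta>)
  then show ?case using mult_left_mono[OF assms(5)[of \<beta>], of c] by (simp add: mult.left_commute)
next
  case (add f g)
  then show ?case by (simp add: distrib_left)
next
  case (agree f g)
  then show ?case using assms(2,3) by simp
qed

lemma kern_line_smooth: "Re \<beta> \<ge> \<gamma> \<Longrightarrow> line_smooth hp (\<lambda>z. kern s (z + \<beta>))"
  unfolding line_smooth_def pder_translate
proof (intro allI ballI)
  fix ds d z assume "Re \<beta> \<ge> \<gamma>" "z \<in> hp"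
  then have "z + \<beta> \<noteq> 0" by (intro hp_shift_nonzero)
  from pder_kern_has_real_derivative[OF this, of ds s d]
  show "((\<lambda>t. pder ds (kern s) (z + of_real t * d + \<beta>)) has_real_derivative
    pder (d # ds) (kern s) (z + \<beta>)) (at 0)"
    by (simp only: add.assoc add.commute[of \<beta>])
qed

lemma cone_line_smooth: "cone f \<Longrightarrow> line_smooth hp f"
proof (induction rule: cone.induct)
  case (atom c \<beta>)
  then show ?case by (intro pder_cmult open_hp kern_line_smooth)
next
  case (agree f g)
  show ?case by (rule line_smooth_cong[OF open_hp agree.IH agree.hyps(2)])
qed (auto intro: line_smooth_const pder_add open_hp)

text \<open>The signs of \<open>lo\<close> and \<open>hi\<close> are what the constants in the cone
  require: their derivatives of positive order are 0.\<close>

lemma cone_pder_le: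
  assumes "cone f" "z \<in> hp" "ds \<noteq> []" "lo \<le> 0" "hi \<ge> 0"
    "\<And>\<beta>. Re \<beta> \<ge> \<gamma> \<Longrightarrow> lo * kern s (z + \<beta>) \<le> pder ds (kern s) (z + \<beta>)"
    "\<And>\<beta>. Re \<beta> \<ge> \<gamma> \<Longrightarrow> pder ds (kern s) (z + \<beta>) \<le> hi * kern s (z + \<beta>)"
  shows "lo * f z \<le> pder ds f z \<and> pder ds f z \<le> hi * f z"
  using assms(1)
proof (induction rule: cone.induct)
  case (const c)
  then show ?case using assms by (simp add: pder_const mult_nonpos_nonneg)
next
  case (atom c \<beta>)
  have "pder ds (\<lambda>z. c * kern s (z + \<beta>)) z = c * pder ds (kern s) (z + \<beta>)"
    using pder_cmult(1)[OF open_hp kern_line_smooth[OF atom(2)] assms(2)] by (simp add: pder_translate)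
  then show ?case
    using mult_left_mono[OF assms(6)[OF atom(2)] atom(1)] mult_left_mono[OF assms(7)[OF atom(2)] atom(1)]
    by (simp add: mult.left_commute)
next
  case (add f g)
  then show ?case
    using pder_add(1)[OF open_hp cone_line_smooth cone_line_smooth assms(2), of f g ds]
    by (simp add: distrib_left)
next
  case (agree f g)
  then show ?case using assms(2) pder_cong[OF open_hp _ assms(2), of f g ds] by simp
qed

lemma m_0 [simp]: "m 0 = (\<lambda>_. 1)" and m_Suc: "m (Suc k) = T (m k)"
  by (simp_all add: m_def)

lemma cone_m: "cone (m k)"
  by (induction k) (auto simp: m_Suc cone_T intro: cone.const)

lemma m_pos: "z \<in> hp \<Longrightarrow> m k z > 0"
proof (induction k arbitrary: z)
  case (Suc k)
  have p: "kern s (z + b) * m k (1 / (z + b)) > 0" if "b \<in> A" for b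
    using Suc.IH[OF branch_hp[OF Suc.prems that]] kern_pos hp_shift_nonzero[OF Suc.prems A[OF that]]
    by simp
  have z0: "m k 0 > 0" using Suc.IH[of 0] by simp
  have nn: "(\<Sum>b\<in>A. kern s (z + b) * m k (1 / (z + b))) \<ge> 0"
    using p by (intro sum_nonneg) (simp add: less_imp_le)
  show ?case
  proof (cases "A = {}")
    case True
    then have "\<alpha> * m k 0 > 0" using nontriv z0 by simp
    then show ?thesis using nn by (simp add: m_Suc T_def)
  next
    case False
    then have "(\<Sum>b\<in>A. kern s (z + b) * m k (1 / (z + b))) > 0"
      using p fin by (intro sum_pos) auto
    then show ?thesis using \<alpha> z0 by (simp add: m_Suc T_def add_pos_nonneg)
  qed
qed simp

text \<open>On \<open>hp\<close> every \<open>z + \<beta>\<close> has modulus above 1/2, so a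
  displacement of length \<open>t\<close> changes the modulus by at most the factor
  \<open>1 + 2 t\<close>. The constant depends neither on \<open>k\<close> nor on
  \<open>\<beta>\<close>.\<close>

lemma m_harnack:
  assumes "z \<in> hp" "z' \<in> hp"
  shows "m k z \<le> (1 + 2 * cmod (z' - z)) powr (2 * s) * m k z'"
proof (rule cone_harnack[OF cone_m assms])
  show "1 \<le> (1 + 2 * cmod (z' - z)) powr (2 * s)" using s by (simp add: ge_one_powr_ge_zero)
  fix \<beta> assume \<beta>: "Re \<beta> \<ge> \<gamma>"
  have "1/2 \<le> cmod (z + \<beta>)" using hp_shift[OF assms(1) \<beta>] complex_Re_le_cmod[of "z + \<beta>"] by linarith
  then have h: "cmod (z' - z) \<le> 2 * cmod (z' - z) * cmod (z + \<beta>)"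
    using mult_left_mono[of "1/2" "cmod (z + \<beta>)" "2 * cmod (z' - z)"] by simp
  have "cmod (z' + \<beta>) \<le> cmod (z + \<beta>) + cmod (z' - z)"
    using norm_triangle_ineq[of "z + \<beta>" "z' - z"] by (simp add: algebra_simps)
  also have "\<dots> \<le> (1 + 2 * cmod (z' - z)) * cmod (z + \<beta>)" using h by (simp add: algebra_simps)
  finally show "kern s (z + \<beta>) \<le> (1 + 2 * cmod (z' - z)) powr (2 * s) * kern s (z' + \<beta>)"
    using s hp_shift_nonzero \<beta> assms by (intro kern_harnack) (auto intro: add_pos_nonneg)
qed

section \<open>Invariant sets and the growth rate at the origin\<close>

definition invariant :: "complex set \<Rightarrow> bool" where
  "invariant S \<longleftrightarrow> 0 \<in> S \<and> (\<forall>z\<in>S. \<forall>b\<in>A. 1 / (z + b) \<in> S)"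

text \<open>Positivity of \<open>T\<close>; iterates evaluated at a point of \<open>S\<close> see
  only values on \<open>S\<close>, so a comparison there suffices.\<close>

lemma Tpow_mono:
  assumes "invariant S" "\<And>u. u \<in> S \<Longrightarrow> f u \<le> c * g u" "u \<in> S"
  shows "(T ^^ k) f u \<le> c * (T ^^ k) g u"
  using assms(3)
proof (induction k arbitrary: u)
  case 0
  then show ?case using assms(2) by simp
next
  case (Suc k)
  let ?f = "(T ^^ k) f" and ?g = "(T ^^ k) g"
  have "kern s (u + b) * ?f (1 / (u + b)) \<le> c * (kern s (u + b) * ?g (1 / (u + b)))" if "b \<in> A" for b
    using mult_left_mono[OF Suc.IH[of "1 / (u + b)"], of "kern s (u + b)"] assms(1) Suc.prems that
    unfolding invariant_def by (simp add: mult.left_commute)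
  then have "(\<Sum>b\<in>A. kern s (u + b) * ?f (1 / (u + b))) \<le> c * (\<Sum>b\<in>A. kern s (u + b) * ?g (1 / (u + b)))"
    unfolding sum_distrib_left by (intro sum_mono)
  moreover have "\<alpha> * ?f 0 \<le> c * (\<alpha> * ?g 0)"
    using mult_left_mono[OF Suc.IH[of 0] \<alpha>] assms(1) by (simp add: invariant_def mult.left_commute)
  ultimately have "T ?f u \<le> c * T ?g u" unfolding T_def by (simp add: distrib_left)
  then show ?case by simp
qed

lemma unit_half_disk_invariant: "invariant {u. Re u \<ge> 0 \<and> cmod u \<le> 1}"
  unfolding invariant_def
proof (intro conjI ballI)
  fix z b assume z: "z \<in> {u. Re u \<ge> 0 \<and> cmod u \<le> 1}" and b: "b \<in> A"
  have 1: "Re (z + b) \<ge> 1" using z A[OF b] \<gamma> by simp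
  then have "cmod (z + b) \<ge> 1" using complex_Re_le_cmod[of "z + b"] by linarith
  then show "1 / (z + b) \<in> {u. Re u \<ge> 0 \<and> cmod u \<le> 1}"
    using Re_inverse_pos[of "z + b"] 1 by (simp add: norm_divide divide_le_eq)
qed simp

text \<open>The value of \<open>T^k (m l)\<close> at 0 involves \<open>m l\<close> only on the
  half-disk, where it is within a factor \<open>H\<close> of \<open>m l 0\<close>. Replacing it by
  that constant gives both quasi-multiplicative bounds.\<close>

lemma growth_rate_exists:
  "\<exists>r>0. \<forall>k. r ^ k \<le> 3 powr (2 * s) * m k 0 \<and> m k 0 \<le> 3 powr (2 * s) * r ^ k"
proof -
  define H where "H = (3::real) powr (2 * s)"
  let ?D = "{u. Re u \<ge> 0 \<and> cmod u \<le> 1}"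
  have H: "H \<ge> 1" using s by (simp add: H_def ge_one_powr_ge_zero)
  have pos: "m k 0 > 0" for k using m_pos[of 0] by simp
  \<comment> \<open>One of the two points is 0 and the other has modulus at most 1, so the Harnack
    factor is at most \<open>3 powr (2 * s)\<close>.\<close>
  have near: "m k u \<le> H * m k v" if "u \<in> ?D" "v \<in> ?D" "u = 0 \<or> v = 0" for u v k
  proof -
    have "m k u \<le> (1 + 2 * cmod (v - u)) powr (2 * s) * m k v"
      using that by (intro m_harnack) auto
    also have "\<dots> \<le> H * m k v"
      unfolding H_def using that s m_pos[of v k] by (intro mult_right_mono powr_mono2) auto
    finally show ?thesis .
  qed
  have split: "m (k + l) = (T ^^ k) (m l)" for k l by (simp add: m_def funpow_add)
  have upper: "m (k + l) 0 \<le> H * m k 0 * m l 0" for k l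
  proof -
    have "(T ^^ k) (m l) 0 \<le> (H * m l 0) * (T ^^ k) (\<lambda>_. 1) 0"
      by (rule Tpow_mono[OF unit_half_disk_invariant]) (use near[of _ 0 l] in auto)
    then show ?thesis unfolding split by (simp add: m_def mult_ac)
  qed
  have lower: "m k 0 * m l 0 \<le> H * m (k + l) 0" for k l
  proof -
    have "(T ^^ k) (\<lambda>_. 1) 0 \<le> (H / m l 0) * (T ^^ k) (m l) 0"
      by (rule Tpow_mono[OF unit_half_disk_invariant]) (use near[of 0 _ l] pos[of l] in \<open>auto simp: field_simps\<close>)
    then have "m k 0 \<le> (H / m l 0) * m (k + l) 0" unfolding split by (simp add: m_def)
    then show ?thesis using pos[of l] by (simp add: field_simps)
  qed
  obtain r where "r > 0" "\<And>k. r ^ k \<le> H * m k 0" "\<And>k. m k 0 \<le> H * r ^ k"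
    using quasi_multiplicative_growth[of "\<lambda>k. m k 0" H] pos H upper lower by auto
  then show ?thesis unfolding H_def by blast
qed

end

subsection \<open>The positive eigenfunction\<close>

locale transfer_limit = transfer_op + lim: banach_limit Lm for Lm +
  fixes r :: real
  assumes r_pos: "r > 0"
    and r_lower: "\<And>k. r ^ k \<le> 3 powr (2 * s) * m k 0"
    and r_upper: "\<And>k. m k 0 \<le> 3 powr (2 * s) * r ^ k"
begin

text \<open>The Harnack factor between 0 and a point of modulus at most \<open>\<rho>\<close>, times
  the error factor of the growth rate at 0.\<close>

definition bnd :: "real \<Rightarrow> real" where
  "bnd \<rho> = (1 + 2 * \<rho>) powr (2 * s) * 3 powr (2 * s)"

lemma bnd_pos: "\<rho> \<ge> 0 \<Longrightarrow> bnd \<rho> > 0"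
  by (simp add: bnd_def)

lemma m_upper:
  assumes "z \<in> hp" "cmod z \<le> \<rho>"
  shows "m k z \<le> bnd \<rho> * r ^ k"
proof -
  have "m k z \<le> (1 + 2 * cmod (0 - z)) powr (2 * s) * m k 0"
    using assms by (intro m_harnack) auto
  also have "\<dots> \<le> (1 + 2 * \<rho>) powr (2 * s) * (3 powr (2 * s) * r ^ k)"
    using assms s r_upper m_pos[of 0 k] by (intro mult_mono powr_mono2) auto
  finally show ?thesis by (simp add: bnd_def mult.assoc)
qed

lemma m_lower:
  assumes "z \<in> hp" "cmod z \<le> \<rho>"
  shows "r ^ k \<le> bnd \<rho> * m k z"
proof -
  have "r ^ k \<le> 3 powr (2 * s) * m k 0" by (rule r_lower)
  also have "m k 0 \<le> (1 + 2 * cmod (z - 0)) powr (2 * s) * m k z"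
    using assms by (intro m_harnack) auto
  also have "\<dots> \<le> (1 + 2 * \<rho>) powr (2 * s) * m k z"
    using assms s m_pos[of z k] by (intro mult_right_mono powr_mono2) auto
  finally show ?thesis by (simp add: bnd_def mult_ac)
qed

text \<open>A fixed constant for the relative kernel bound; asking for \<open>C \<ge> 1\<close>
  makes it usable for the empty list as well, where \<open>pder\<close> is the function
  itself.\<close>

definition pbd :: "complex list \<Rightarrow> real" where
  "pbd ds = (SOME C. C \<ge> 1 \<and> (\<forall>\<zeta>. Re \<zeta> > 1/2 \<longrightarrow> \<bar>pder ds (kern s) \<zeta>\<bar> \<le> C * kern s \<zeta>))"

lemma pbd: "pbd ds \<ge> 1" "Re \<zeta> > 1/2 \<Longrightarrow> \<bar>pder ds (kern s) \<zeta>\<bar> \<le> pbd ds * kern s \<zeta>"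
proof -
  obtain C where C: "C \<ge> 0" "\<And>\<zeta>. Re \<zeta> > 1/2 \<Longrightarrow> \<bar>pder ds (kern s) \<zeta>\<bar> \<le> C * kern s \<zeta>"
    using pder_kern_bound by blast
  have "\<bar>pder ds (kern s) \<zeta>\<bar> \<le> (C + 1) * kern s \<zeta>" if "Re \<zeta> > 1/2" for \<zeta>
    using C(2)[OF that] kern_nonneg[of s \<zeta>] unfolding distrib_right by linarith
  then have "\<exists>C. C \<ge> 1 \<and> (\<forall>\<zeta>. Re \<zeta> > 1/2 \<longrightarrow> \<bar>pder ds (kern s) \<zeta>\<bar> \<le> C * kern s \<zeta>)"
    using C(1) by (intro exI[of _ "C + 1"]) auto
  from someI_ex[OF this] show "pbd ds \<ge> 1" "Re \<zeta> > 1/2 \<Longrightarrow> \<bar>pder ds (kern s) \<zeta>\<bar> \<le> pbd ds * kern s \<zeta>"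
    unfolding pbd_def by blast+
qed

lemma pder_m_le:
  assumes z: "z \<in> hp"
  shows "\<bar>pder ds (m k) z\<bar> \<le> pbd ds * m k z"
proof (cases "ds = []")
  case True
  then show ?thesis using pbd(1)[of ds] m_pos[OF z, of k] by simp
next
  case False
  have K: "\<bar>pder ds (kern s) (z + \<beta>)\<bar> \<le> pbd ds * kern s (z + \<beta>)" if "Re \<beta> \<ge> \<gamma>" for \<beta>
    by (rule pbd(2)[OF hp_shift[OF z that]])
  have "- pbd ds * m k z \<le> pder ds (m k) z \<and> pder ds (m k) z \<le> pbd ds * m k z"
  proof (rule cone_pder_le[OF cone_m z False])
    fix \<beta> assume "Re \<beta> \<ge> \<gamma>"
    from K[OF this] show "- pbd ds * kern s (z + \<beta>) \<le> pder ds (kern s) (z + \<beta>)"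
      "pder ds (kern s) (z + \<beta>) \<le> pbd ds * kern s (z + \<beta>)" by linarith+
  qed (use pbd(1)[of ds] in auto)
  then show ?thesis by linarith
qed

lemma pder_m_bounded:
  assumes "z \<in> hp" "cmod z \<le> \<rho>"
  shows "\<bar>pder ds (m k) z / r ^ k\<bar> \<le> pbd ds * bnd \<rho>"
proof -
  have "\<bar>pder ds (m k) z\<bar> \<le> pbd ds * (bnd \<rho> * r ^ k)"
    using pder_m_le[OF assms(1), of ds k] m_upper[OF assms, of k] pbd(1)[of ds]
    by (smt (verit) mult_left_mono)
  then show ?thesis using r_pos by (simp add: abs_divide divide_le_eq mult.assoc)
qed

lemma Bseq_pder_m: "z \<in> hp \<Longrightarrow> Bseq (\<lambda>k. pder ds (m k) z / r ^ k)"
  using pder_m_bounded[of z "cmod z" ds] by (intro BseqI'[of _ "pbd ds * bnd (cmod z)"]) simp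

section \<open>Differentiation and continuity of the Banach limit\<close>

definition W :: "complex list \<Rightarrow> complex \<Rightarrow> real" where
  "W ds z = Lm (\<lambda>k. pder ds (m k) z / r ^ k)"

definition w :: "complex \<Rightarrow> real" where
  "w z = Lm (\<lambda>k. m k z / r ^ k)"

lemma W_Nil: "W [] = w"
  by (simp add: W_def w_def fun_eq_iff)

lemma Bseq_m: "z \<in> hp \<Longrightarrow> Bseq (\<lambda>k. m k z / r ^ k)"
  using Bseq_pder_m[of z "[]"] by simp

lemma W_bounded: "z \<in> hp \<Longrightarrow> cmod z \<le> \<rho> \<Longrightarrow> \<bar>W ds z\<bar> \<le> pbd ds * bnd \<rho>"
  unfolding W_def by (intro lim.abs_le Bseq_pder_m pder_m_bounded)

lemma pder_m_line_derivative:
  assumes "z + of_real t * d \<in> hp"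
  shows "((\<lambda>t::real. pder ds (m k) (z + of_real t * d) / r ^ k) has_real_derivative
      pder (d # ds) (m k) (z + of_real t * d) / r ^ k) (at t)"
proof -
  have "((\<lambda>u::real. pder ds (m k) ((z + of_real t * d) + of_real u * d)) has_real_derivative
      pder (d # ds) (m k) (z + of_real t * d)) (at 0)"
    using cone_line_smooth[OF cone_m, of k] assms unfolding line_smooth_def by blast
  then have "((\<lambda>u::real. pder ds (m k) (z + of_real u * d)) has_real_derivative
      pder (d # ds) (m k) (z + of_real t * d)) (at (0 + t))"
    by (subst DERIV_shift) (simp add: algebra_simps)
  then show ?thesis by (intro DERIV_cdivide) simp
qed

text \<open>The bound for the list \<open>d # d # ds\<close> supplies the uniform second derivative
  along the line that differentiation under the limit requires.\<close>

lemma W_line_derivative: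
  assumes z: "z \<in> hp"
  shows "((\<lambda>t::real. W ds (z + of_real t * d)) has_real_derivative W (d # ds) z) (at 0)"
proof -
  obtain e where e: "e > 0" "ball z e \<subseteq> hp" using open_hp z open_contains_ball by blast
  \<comment> \<open>Scaled so that the points \<open>z + t d\<close> stay in the ball around
    \<open>z\<close>; the added 1 covers \<open>d = 0\<close>.\<close>
  define e' where "e' = e / (1 + cmod d)"
  have d1: "1 + cmod d > 0" by (simp add: add_pos_nonneg)
  have e': "e' > 0" using e(1) d1 by (simp add: e'_def)
  have near: "cmod (of_real t * d) < e" if "\<bar>t\<bar> < e'" for t :: real
  proof -
    have "\<bar>t\<bar> * (1 + cmod d) < e" using that d1 by (simp add: e'_def field_simps)
    then have "\<bar>t\<bar> + \<bar>t\<bar> * cmod d < e" by (simp add: distrib_left)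
    then show ?thesis using abs_ge_zero[of t] by (simp add: norm_mult)
  qed
  have in_hp: "z + of_real t * d \<in> hp" if "\<bar>t\<bar> < e'" for t
    using near[OF that] e(2) by (metis dist_norm add_diff_cancel_left' mem_ball dist_commute subsetD)
  have small: "cmod (z + of_real t * d) \<le> cmod z + e" if "\<bar>t\<bar> < e'" for t
    using near[OF that] norm_triangle_ineq[of z "of_real t * d"] by linarith
  have "((\<lambda>t. Lm (\<lambda>k. pder ds (m k) (z + of_real t * d) / r ^ k)) has_real_derivative
     Lm (\<lambda>k. pder (d # ds) (m k) (z + of_real 0 * d) / r ^ k)) (at 0)"
  proof (rule lim.has_real_derivative[OF e'])
    fix k and t :: real assume t: "\<bar>t\<bar> < e'"
    show "((\<lambda>t. pder ds (m k) (z + of_real t * d) / r ^ k) has_real_derivative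
      pder (d # ds) (m k) (z + of_real t * d) / r ^ k) (at t)"
      by (rule pder_m_line_derivative[OF in_hp[OF t]])
    show "((\<lambda>t. pder (d # ds) (m k) (z + of_real t * d) / r ^ k) has_real_derivative
      pder (d # d # ds) (m k) (z + of_real t * d) / r ^ k) (at t)"
      by (rule pder_m_line_derivative[OF in_hp[OF t]])
    show "\<bar>pder (d # d # ds) (m k) (z + of_real t * d) / r ^ k\<bar> \<le> pbd (d # d # ds) * bnd (cmod z + e)"
      by (rule pder_m_bounded[OF in_hp[OF t] small[OF t]])
  next
    fix t :: real assume "\<bar>t\<bar> < e'"
    then show "Bseq (\<lambda>k. pder ds (m k) (z + of_real t * d) / r ^ k)" by (intro Bseq_pder_m in_hp)
  next
    show "Bseq (\<lambda>k. pder (d # ds) (m k) (z + of_real 0 * d) / r ^ k)"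
      by (intro Bseq_pder_m in_hp) (simp add: e')
  qed
  then show ?thesis unfolding W_def by simp
qed

lemma pder_w: "z \<in> hp \<Longrightarrow> pder ds w z = W ds z"
proof (induction ds arbitrary: z)
  case Nil
  then show ?case by (simp add: W_Nil)
next
  case (Cons d ds)
  have "pdir d (pder ds w) z = pdir d (W ds) z" by (rule pdir_cong[OF open_hp Cons.prems Cons.IH])
  also have "\<dots> = W (d # ds) z" by (rule pdir_eqI[OF W_line_derivative[OF Cons.prems]])
  finally show ?case by simp
qed

lemma pder_w_differentiable:
  assumes "z \<in> hp"
  shows "(\<lambda>t::real. pder ds w (z + of_real t * d)) differentiable (at 0)"
proof -
  have "((\<lambda>t::real. pder ds w (z + of_real t * d)) has_real_derivative W (d # ds) z) (at 0)"
    by (rule has_real_derivative_line_cong[OF open_hp assms _ W_line_derivative[OF assms]])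
      (rule pder_w[symmetric])
  then show ?thesis using real_differentiable_def by blast
qed

lemma W_segment_bound:
  fixes h :: real
  assumes "\<And>t. t \<in> closed_segment 0 h \<Longrightarrow> z + of_real t * d \<in> hp \<and> cmod (z + of_real t * d) \<le> \<rho>"
  shows "\<bar>W ds (z + of_real h * d) - W ds z\<bar> \<le> pbd (d # ds) * bnd \<rho> * \<bar>h\<bar>"
proof -
  have "norm (W ds (z + of_real h * d) - W ds (z + of_real 0 * d)) \<le> pbd (d # ds) * bnd \<rho> * norm (h - 0)"
  proof (rule field_differentiable_bound[of "closed_segment 0 h" _ "\<lambda>t. W (d # ds) (z + of_real t * d)"])
    fix t assume t: "t \<in> closed_segment 0 h"
    have "((\<lambda>u::real. W ds ((z + of_real t * d) + of_real u * d)) has_real_derivative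
      W (d # ds) (z + of_real t * d)) (at 0)"
      using W_line_derivative assms[OF t] by blast
    then have "((\<lambda>u::real. W ds (z + of_real u * d)) has_real_derivative
      W (d # ds) (z + of_real t * d)) (at (0 + t))"
      by (subst DERIV_shift) (simp add: algebra_simps)
    from has_field_derivative_at_within[OF this]
    show "((\<lambda>u::real. W ds (z + of_real u * d)) has_real_derivative
      W (d # ds) (z + of_real t * d)) (at t within closed_segment 0 h)" by simp
    show "norm (W (d # ds) (z + of_real t * d)) \<le> pbd (d # ds) * bnd \<rho>"
      using W_bounded assms[OF t] by simp
  qed auto
  then show ?thesis by simp
qed

text \<open>Bounded derivatives in the two coordinate directions make \<open>W ds\<close> Lipschitz
  near each point.\<close>

lemma W_continuous: "continuous_on hp (W ds)"
  unfolding continuous_on_eq_continuous_at[OF open_hp]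
proof
  fix z assume z: "z \<in> hp"
  obtain e where e: "e > 0" "ball z e \<subseteq> hp" using open_hp z open_contains_ball by blast
  define K where "K = (pbd (1 # ds) + pbd (\<i> # ds)) * bnd (cmod z + e)"
  have lip: "\<bar>W ds u - W ds z\<bar> \<le> K * cmod (u - z)" if u: "u \<in> ball z e" for u
  proof -
    have ue: "cmod (u - z) < e" using u by (simp add: dist_norm norm_minus_commute)
    have good: "v \<in> hp \<and> cmod v \<le> cmod z + e" if "cmod (v - z) \<le> cmod (u - z)" for v
    proof -
      have "v \<in> ball z e" using that ue by (simp add: dist_norm norm_minus_commute)
      moreover have "cmod v \<le> cmod z + cmod (v - z)" by (metis add.commute norm_triangle_sub)
      ultimately show ?thesis using e(2) that ue by auto
    qed
    \<comment> \<open>Corner of the path from \<open>z\<close> to \<open>u\<close> that runs first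
      horizontally, then vertically; the whole path stays within distance
      \<open>cmod (u - z)\<close> of \<open>z\<close>.\<close>
    define c where "c = z + of_real (Re (u - z)) * 1"
    have uc: "u = c + of_real (Im (u - z)) * \<i>" by (simp add: c_def complex_eq_iff)
    have 1: "\<bar>W ds (z + of_real (Re (u - z)) * 1) - W ds z\<bar>
        \<le> pbd (1 # ds) * bnd (cmod z + e) * \<bar>Re (u - z)\<bar>"
    proof (rule W_segment_bound, rule good)
      fix t assume "t \<in> closed_segment 0 (Re (u - z))"
      then have "\<bar>t\<bar> \<le> \<bar>Re (u - z)\<bar>" by (auto simp: closed_segment_eq_real_ivl split: if_splits)
      then show "cmod (z + of_real t * 1 - z) \<le> cmod (u - z)"
        using abs_Re_le_cmod[of "u - z"] by simp
    qed
    have 2: "\<bar>W ds (c + of_real (Im (u - z)) * \<i>) - W ds c\<bar>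
        \<le> pbd (\<i> # ds) * bnd (cmod z + e) * \<bar>Im (u - z)\<bar>"
    proof (rule W_segment_bound, rule good)
      fix t assume "t \<in> closed_segment 0 (Im (u - z))"
      then have "\<bar>t\<bar> \<le> \<bar>Im (u - z)\<bar>" by (auto simp: closed_segment_eq_real_ivl split: if_splits)
      then have "t^2 \<le> (Im (u - z))^2" using abs_le_square_iff by blast
      then show "cmod (c + of_real t * \<i> - z) \<le> cmod (u - z)"
        unfolding c_def cmod_def by (intro real_sqrt_le_mono) simp
    qed
    have B: "bnd (cmod z + e) > 0" using e(1) by (intro bnd_pos) simp
    have P: "pbd (1 # ds) > 0" "pbd (\<i> # ds) > 0" using pbd(1)[of "1 # ds"] pbd(1)[of "\<i> # ds"] by linarith+
    have "\<bar>W ds u - W ds z\<bar> \<le> \<bar>W ds (c + of_real (Im (u - z)) * \<i>) - W ds c\<bar> + \<bar>W ds c - W ds z\<bar>"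
      using uc by simp
    also have "\<dots> \<le> pbd (\<i> # ds) * bnd (cmod z + e) * cmod (u - z) + pbd (1 # ds) * bnd (cmod z + e) * cmod (u - z)"
    proof (rule add_mono)
      show "\<bar>W ds (c + of_real (Im (u - z)) * \<i>) - W ds c\<bar> \<le> pbd (\<i> # ds) * bnd (cmod z + e) * cmod (u - z)"
        using P B by (intro order_trans[OF 2] mult_left_mono abs_Im_le_cmod) simp
      show "\<bar>W ds c - W ds z\<bar> \<le> pbd (1 # ds) * bnd (cmod z + e) * cmod (u - z)"
        unfolding c_def using P B by (intro order_trans[OF 1] mult_left_mono abs_Re_le_cmod) simp
    qed
    finally show ?thesis by (simp add: K_def algebra_simps)
  qed
  have "((\<lambda>u. W ds u - W ds z) \<longlongrightarrow> 0) (at z)"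
  proof (rule Lim_null_comparison)
    show "eventually (\<lambda>u. norm (W ds u - W ds z) \<le> K * cmod (u - z)) (at z)"
      using e(1) lip by (intro eventually_mono[OF eventually_at_in_open'[of "ball z e"]]) auto
    have "((\<lambda>u. K * cmod (u - z)) \<longlongrightarrow> K * cmod (z - z)) (at z)" by (intro tendsto_intros)
    then show "((\<lambda>u. K * cmod (u - z)) \<longlongrightarrow> 0) (at z)" by simp
  qed
  then show "isCont (W ds) z" by (simp add: isCont_def LIM_zero_iff)
qed

lemma w_pos:
  assumes "z \<in> hp"
  shows "w z > 0"
proof -
  have B: "bnd (cmod z) > 0" by (simp add: bnd_pos)
  have "1 / bnd (cmod z) \<le> m k z / r ^ k" for k
    using m_lower[OF assms order_refl, of k] B r_pos by (simp add: field_simps)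
  then have "1 / bnd (cmod z) \<le> w z" unfolding w_def by (intro lim.ge Bseq_m assms)
  then show ?thesis using less_le_trans[of 0 "1 / bnd (cmod z)"] B by simp
qed

lemma T_w:
  assumes z: "z \<in> hp"
  shows "T w z = r * w z"
proof -
  let ?x = "\<lambda>u k. m k u / r ^ k"
  have b: "Bseq (\<lambda>k. kern s (z + b) * ?x (1 / (z + b)) k)" if "b \<in> A" for b
    by (intro Bseq_mult Bseq_m branch_hp z that) simp
  have b0: "Bseq (?x 0)" by (rule Bseq_m) simp
  then have b0': "Bseq (\<lambda>k. \<alpha> * ?x 0 k)" by (intro Bseq_mult) simp
  have "T w z = (\<Sum>b\<in>A. Lm (\<lambda>k. kern s (z + b) * ?x (1 / (z + b)) k)) + Lm (\<lambda>k. \<alpha> * ?x 0 k)"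
    unfolding T_def w_def using lim.scale[OF b0] lim.scale[OF Bseq_m[OF branch_hp[OF z]]] by simp
  also have "\<dots> = Lm (\<lambda>k. (\<Sum>b\<in>A. kern s (z + b) * ?x (1 / (z + b)) k) + \<alpha> * ?x 0 k)"
    using lim.sum[OF fin b] lim.add[OF lim.Bseq_sum[OF fin b] b0'] by simp
  \<comment> \<open>The operator turns the \<open>k\<close>-th normalised iterate into the next one,
    with one spare factor \<open>r\<close>.\<close>
  also have "\<dots> = Lm (\<lambda>k. r * ?x z (Suc k))"
  proof (rule arg_cong[where f = Lm], rule ext)
    fix k
    have "r * ?x z (Suc k) = T (m k) z / r ^ k" using r_pos by (simp add: m_Suc)
    then show "(\<Sum>b\<in>A. kern s (z + b) * ?x (1 / (z + b)) k) + \<alpha> * ?x 0 k = r * ?x z (Suc k)"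
      by (simp add: T_def add_divide_distrib sum_divide_distrib)
  qed
  also have "\<dots> = r * w z"
    using lim.scale[of "\<lambda>k. ?x z (Suc k)" r] lim.shift[OF Bseq_m[OF z]] Bseq_Suc_iff[of "?x z"] Bseq_m[OF z]
    unfolding w_def by simp
  finally show ?thesis .
qed

section \<open>Inequalities and symmetry inherited by the eigenfunction\<close>

lemma w_harnack:
  assumes "z \<in> hp" "z' \<in> hp" "H \<ge> 1"
    "\<And>\<beta>. Re \<beta> \<ge> \<gamma> \<Longrightarrow> kern s (z + \<beta>) \<le> H * kern s (z' + \<beta>)"
  shows "w z \<le> H * w z'"
proof -
  have b: "Bseq (\<lambda>k. H * (m k z' / r ^ k))" by (intro Bseq_mult Bseq_m assms) simp
  have "m k z / r ^ k \<le> H * (m k z' / r ^ k)" for k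
    using cone_harnack[OF cone_m assms, of k] r_pos by (simp add: divide_right_mono)
  then have "w z \<le> Lm (\<lambda>k. H * (m k z' / r ^ k))"
    unfolding w_def by (intro lim.mono Bseq_m assms b)
  also have "\<dots> = H * w z'" unfolding w_def by (intro lim.scale Bseq_m assms)
  finally show ?thesis .
qed

lemma W_le:
  assumes z: "z \<in> hp" and ds: "ds \<noteq> []" "lo \<le> 0" "hi \<ge> 0"
    "\<And>\<beta>. Re \<beta> \<ge> \<gamma> \<Longrightarrow> lo * kern s (z + \<beta>) \<le> pder ds (kern s) (z + \<beta>)"
    "\<And>\<beta>. Re \<beta> \<ge> \<gamma> \<Longrightarrow> pder ds (kern s) (z + \<beta>) \<le> hi * kern s (z + \<beta>)"
  shows "lo * w z \<le> W ds z" "W ds z \<le> hi * w z"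
proof -
  have b: "Bseq (\<lambda>k. c * (m k z / r ^ k))" for c by (intro Bseq_mult Bseq_m z) simp
  have sc: "Lm (\<lambda>k. c * (m k z / r ^ k)) = c * w z" for c unfolding w_def by (intro lim.scale Bseq_m z)
  note c = cone_pder_le[OF cone_m assms]
  have "lo * (m k z / r ^ k) \<le> pder ds (m k) z / r ^ k" for k
    using divide_right_mono[OF conjunct1[OF c[of k]], of "r ^ k"] r_pos by simp
  then have "Lm (\<lambda>k. lo * (m k z / r ^ k)) \<le> W ds z"
    unfolding W_def by (intro lim.mono b Bseq_pder_m z)
  then show "lo * w z \<le> W ds z" unfolding sc .
  have "pder ds (m k) z / r ^ k \<le> hi * (m k z / r ^ k)" for k
    using divide_right_mono[OF conjunct2[OF c[of k]], of "r ^ k"] r_pos by simp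
  then have "W ds z \<le> Lm (\<lambda>k. hi * (m k z / r ^ k))"
    unfolding W_def by (intro lim.mono b Bseq_pder_m z)
  then show "W ds z \<le> hi * w z" unfolding sc .
qed

text \<open>Conjugation permutes the branches, so the symmetry holds for every iterate and then for
  the limit of identical sequences.\<close>

lemma m_cnj:
  assumes "\<And>b. b \<in> A \<Longrightarrow> cnj b \<in> A"
  shows "m k (cnj z) = m k z"
proof (induction k arbitrary: z)
  case (Suc k)
  have "(\<Sum>b\<in>A. kern s (cnj z + b) * m k (1 / (cnj z + b)))
    = (\<Sum>b\<in>A. kern s (z + b) * m k (1 / (z + b)))"
  proof (rule sum.reindex_bij_witness[of _ cnj cnj])
    fix b assume "b \<in> A"
    have c: "cnj z + b = cnj (z + cnj b)" by simp
    have "1 / (cnj z + b) = cnj (1 / (z + cnj b))" by simp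
    then have "m k (1 / (cnj z + b)) = m k (1 / (z + cnj b))" by (simp only: Suc.IH)
    moreover have "kern s (cnj z + b) = kern s (z + cnj b)"
      unfolding c kern_def by (simp only: complex_mod_cnj)
    ultimately show "kern s (z + cnj b) * m k (1 / (z + cnj b)) = kern s (cnj z + b) * m k (1 / (cnj z + b))"
      by simp
  qed (use assms in auto)
  then show ?case by (simp add: m_Suc T_def)
qed simp

lemma w_cnj: "(\<And>b. b \<in> A \<Longrightarrow> cnj b \<in> A) \<Longrightarrow> w (cnj z) = w z"
  by (simp add: w_def m_cnj)

end

subsection \<open>Uniqueness and the spectral radius\<close>

lemma norm_reciprocal_diff:
  fixes z p b :: complex
  assumes "z + b \<noteq> 0" "p + b \<noteq> 0"
  shows "cmod (1 / (z + b) - 1 / (p + b)) = cmod (z - p) / (cmod (z + b) * cmod (p + b))"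
proof -
  have "1 / (z + b) - 1 / (p + b) = (p - z) / ((z + b) * (p + b))"
    using assms by (simp add: field_simps)
  then show ?thesis by (simp add: norm_divide norm_mult norm_minus_commute)
qed

context transfer_limit
begin

text \<open>If \<open>u(p) = 0\<close> then \<open>u\<close> vanishes along the whole orbit of \<open>p\<close>; the orbit of any
  other point approaches that of \<open>p\<close>, which bounds \<open>u\<close> by \<open>\<epsilon> m\<^sub>n / r\<^sup>n\<close>. The branches contract
  strictly only on \<open>Re z \<ge> \<kappa>\<close>, a region reached after one step.\<close>

lemma eigenfunction_with_zero_vanishes:
  fixes S :: "complex set" and u :: "complex \<Rightarrow> real"
  assumes S: "compact S" "S \<subseteq> {z. Re z \<ge> 0}" "invariant S"
    and u: "continuous_on S u" "\<And>z. z \<in> S \<Longrightarrow> u z \<ge> 0" "\<And>z. z \<in> S \<Longrightarrow> T u z = r * u z"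
    and p0: "p0 \<in> S" "u p0 = 0" and z0: "z0 \<in> S"
  shows "u z0 = 0"
proof -
  have inv: "0 \<in> S" "\<And>z b. z \<in> S \<Longrightarrow> b \<in> A \<Longrightarrow> 1 / (z + b) \<in> S"
    using S(3) by (auto simp: invariant_def)
  have hp: "z \<in> hp" if "z \<in> S" for z using that S(2) by auto
  \<comment> \<open>At a zero of \<open>u\<close> the eigenvalue equation is a vanishing sum of
    nonnegative terms with positive kernel weights, so the terms vanish one by one.\<close>
  have zero: "(\<forall>b\<in>A. u (1 / (p + b)) = 0) \<and> (\<alpha> > 0 \<longrightarrow> u 0 = 0)" if p: "p \<in> S" "u p = 0" for p
  proof -
    have t: "(\<Sum>b\<in>A. kern s (p + b) * u (1 / (p + b))) + \<alpha> * u 0 = 0"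
      using u(3)[OF p(1)] p(2) by (simp add: T_def)
    have n1: "kern s (p + b) * u (1 / (p + b)) \<ge> 0" if "b \<in> A" for b
      using u(2)[OF inv(2)[OF p(1) that]] by simp
    have n2: "\<alpha> * u 0 \<ge> 0" using \<alpha> u(2)[OF inv(1)] by simp
    have "(\<Sum>b\<in>A. kern s (p + b) * u (1 / (p + b))) = 0" and a: "\<alpha> * u 0 = 0"
      using t n2 sum_nonneg[of A "\<lambda>b. kern s (p + b) * u (1 / (p + b))", OF n1] by linarith+
    then have "\<forall>b\<in>A. kern s (p + b) * u (1 / (p + b)) = 0"
      using sum_nonneg_eq_0_iff[OF fin, of "\<lambda>b. kern s (p + b) * u (1 / (p + b))"] n1 by blast
    moreover have "kern s (p + b) \<noteq> 0" if "b \<in> A" for b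
      using kern_pos[OF hp_shift_nonzero[OF hp[OF p(1)] A[OF that]], of s] by simp
    ultimately show ?thesis using a by auto
  qed
  \<comment> \<open>The zero \<open>p\<close> serves to kill the term at the origin: it gives
    \<open>u 0 = 0\<close> whenever \<open>\<alpha> > 0\<close>, so only the branches need a
    hypothesis.\<close>
  have one_step: "u z \<le> \<epsilon> * m (Suc n) z / r ^ Suc n"
    if z: "z \<in> S" and p: "p \<in> S" "u p = 0"
      and b: "\<And>b. b \<in> A \<Longrightarrow> u (1 / (z + b)) \<le> \<epsilon> * m n (1 / (z + b)) / r ^ n" and \<epsilon>: "\<epsilon> > 0"
    for z p n \<epsilon>
  proof -
    have u0: "\<alpha> * u 0 \<le> \<alpha> * (\<epsilon> * m n 0 / r ^ n)"
    proof (cases "\<alpha> = 0")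
      case False
      then have "u 0 = 0" using zero[OF p] \<alpha> by auto
      then show ?thesis using \<alpha> \<epsilon> r_pos m_pos[of 0 n] by simp
    qed simp
    have "r * u z = T u z" using u(3)[OF z] by simp
    also have "\<dots> \<le> (\<Sum>b\<in>A. kern s (z + b) * (\<epsilon> * m n (1 / (z + b)) / r ^ n)) + \<alpha> * (\<epsilon> * m n 0 / r ^ n)"
      unfolding T_def using b by (intro add_mono u0 sum_mono mult_left_mono) auto
    also have "\<dots> = \<epsilon> / r ^ n * m (Suc n) z"
      by (simp add: m_Suc T_def distrib_left sum_distrib_left mult_ac)
    finally have "r * u z \<le> \<epsilon> / r ^ n * m (Suc n) z" .
    then show ?thesis using r_pos by (simp add: le_divide_eq mult_ac)
  qed
  obtain \<rho> where \<rho>: "\<And>z. z \<in> S \<Longrightarrow> cmod z \<le> \<rho>"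
    using compact_imp_bounded[OF S(1)] unfolding bounded_iff by blast
  have \<rho>0: "\<rho> \<ge> 0" using \<rho>[OF inv(1)] by simp
  obtain R where R: "\<And>b. b \<in> A \<Longrightarrow> cmod b \<le> R" "R \<ge> 1"
  proof
    show "\<And>b. b \<in> A \<Longrightarrow> cmod b \<le> Max (insert 1 (cmod ` A))" "Max (insert 1 (cmod ` A)) \<ge> 1"
      using fin by auto
  qed
  \<comment> \<open>Lower bound for \<open>Re (1 / (z + b)) = Re (z + b) / |z + b|^2\<close>, from
    \<open>Re (z + b) \<ge> 1\<close> and \<open>|z + b| \<le> \<rho> + R\<close>.\<close>
  define \<kappa> where "\<kappa> = 1 / (\<rho> + R)^2"
  have \<kappa>: "\<kappa> > 0" using \<rho>0 R(2) by (simp add: \<kappa>_def)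
  have Re1: "Re (z + b) \<ge> 1" if "z \<in> S" "b \<in> A" for z b
    using that S(2) A[of b] \<gamma> by fastforce
  have Re_branch: "Re (1 / (z + b)) \<ge> \<kappa>" if z: "z \<in> S" and b: "b \<in> A" for z b
  proof -
    have 1: "Re (z + b) \<ge> 1" by (rule Re1[OF z b])
    then have c: "cmod (z + b) > 0" using complex_Re_le_cmod[of "z + b"] by linarith
    have "cmod (z + b) \<le> \<rho> + R" using norm_triangle_ineq[of z b] \<rho>[OF z] R(1)[OF b] by linarith
    then have "(cmod (z + b))^2 \<le> (\<rho> + R)^2" by (intro power_mono) auto
    then have "\<kappa> \<le> 1 / (cmod (z + b))^2" unfolding \<kappa>_def using c by (intro divide_left_mono mult_pos_pos) auto
    also have "\<dots> \<le> Re (z + b) / (cmod (z + b))^2" using 1 by (intro divide_right_mono) auto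
    also have "\<dots> = Re (1 / (z + b))" by (simp add: Re_divide cmod_power2)
    finally show ?thesis .
  qed
  \<comment> \<open>Pairs of a point and a nearby zero. The tolerance is used as
    \<open>\<delta> * (1 + \<kappa>) ^ n\<close> with \<open>n\<close> branches still to be applied;
    at \<open>n = 0\<close> uniform continuity gives \<open>u z \<le> \<epsilon>\<close>.\<close>
  define Q where "Q \<delta> z p \<longleftrightarrow> z \<in> S \<and> p \<in> S \<and> u p = 0 \<and>
     (z = p \<or> cmod (z - p) \<le> \<delta> \<and> Re z \<ge> \<kappa> \<and> Re p \<ge> \<kappa>)" for \<delta> z p
  have main: "u z0 \<le> \<epsilon> * bnd \<rho>" if \<epsilon>: "\<epsilon> > 0" for \<epsilon>
  proof -
    have "uniformly_continuous_on S u" using compact_uniformly_continuous[OF u(1) S(1)] .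
    then obtain \<delta>0 where \<delta>0: "\<delta>0 > 0" "\<And>z p. z \<in> S \<Longrightarrow> p \<in> S \<Longrightarrow> dist z p < \<delta>0 \<Longrightarrow> dist (u z) (u p) < \<epsilon>"
      unfolding uniformly_continuous_on_def using \<epsilon> by metis
    define \<delta> where "\<delta> = \<delta>0 / 2"
    have \<delta>: "\<delta> > 0" "\<delta> < \<delta>0" using \<delta>0 by (auto simp: \<delta>_def)
    have step: "u z \<le> \<epsilon> * m n z / r ^ n" if "Q (\<delta> * (1 + \<kappa>) ^ n) z p" for n z p
      using that
    proof (induction n arbitrary: z p)
      case 0
      then have "z = p \<or> cmod (z - p) \<le> \<delta>" by (auto simp: Q_def)
      then have "dist z p < \<delta>0" using \<delta> \<delta>0(1) by (auto simp: dist_norm)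
      moreover have "z \<in> S" "p \<in> S" using 0 by (auto simp: Q_def)
      ultimately have "dist (u z) (u p) < \<epsilon>" by (intro \<delta>0(2))
      then show ?case using 0 by (auto simp: Q_def dist_real_def)
    next
      case (Suc n)
      have zS: "z \<in> S" "p \<in> S" "u p = 0" using Suc.prems by (auto simp: Q_def)
      have b: "u (1 / (z + b)) \<le> \<epsilon> * m n (1 / (z + b)) / r ^ n" if b: "b \<in> A" for b
      proof (rule Suc.IH)
        show "Q (\<delta> * (1 + \<kappa>) ^ n) (1 / (z + b)) (1 / (p + b))"
        proof (cases "z = p")
          case True
          then show ?thesis using zS inv(2) b zero by (auto simp: Q_def)
        next
          case False
          then have h: "cmod (z - p) \<le> \<delta> * (1 + \<kappa>) ^ Suc n" "Re z \<ge> \<kappa>" "Re p \<ge> \<kappa>"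
            using Suc.prems by (auto simp: Q_def)
          \<comment> \<open>Here \<open>Re z \<ge> \<kappa>\<close> is spent: the distance is
            divided by at least \<open>1 + \<kappa>\<close>.\<close>
          have z1: "cmod (z + b) \<ge> 1 + \<kappa>"
            using h(2) A[OF b] \<gamma> complex_Re_le_cmod[of "z + b"] by simp
          have p1: "cmod (p + b) \<ge> 1"
            using complex_Re_le_cmod[of "p + b"] Re1[OF zS(2) b] by linarith
          have "1 + \<kappa> \<le> cmod (z + b) * cmod (p + b)"
            using mult_mono[OF z1 p1] \<kappa> by simp
          moreover have "z + b \<noteq> 0" "p + b \<noteq> 0" using z1 p1 \<kappa> by auto
          ultimately have "cmod (1 / (z + b) - 1 / (p + b)) \<le> cmod (z - p) / (1 + \<kappa>)"
            using \<kappa> unfolding norm_reciprocal_diff[OF \<open>z + b \<noteq> 0\<close> \<open>p + b \<noteq> 0\<close>]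
            by (intro divide_left_mono) auto
          also have "\<dots> \<le> \<delta> * (1 + \<kappa>) ^ n" using h(1) \<kappa> by (simp add: divide_le_eq mult_ac)
          finally show ?thesis using zS inv(2) b zero Re_branch by (auto simp: Q_def)
        qed
      qed
      show ?case by (rule one_step[OF zS b \<epsilon>])
    qed
    \<comment> \<open>With this \<open>n\<close> the tolerance exceeds the diameter of
      \<open>S\<close>, so any two points of \<open>S\<close> are close enough to start.\<close>
    obtain n where n: "2 * \<rho> / \<delta> < (1 + \<kappa>) ^ n" using real_arch_pow[of "1 + \<kappa>" "2 * \<rho> / \<delta>"] \<kappa> by auto
    have far: "cmod (z - p) \<le> \<delta> * (1 + \<kappa>) ^ n" if "z \<in> S" "p \<in> S" for z p
    proof -
      have "cmod (z - p) \<le> 2 * \<rho>" using norm_triangle_ineq4[of z p] \<rho>[OF that(1)] \<rho>[OF that(2)] by linarith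
      also have "\<dots> \<le> \<delta> * (1 + \<kappa>) ^ n" using n \<delta>(1) by (simp add: divide_less_eq mult.commute)
      finally show ?thesis .
    qed
    \<comment> \<open>\<open>z0\<close> and \<open>p0\<close> themselves may have small real part,
      so one branch is applied before the induction is used; this accounts for \<open>Suc n\<close>
      below.\<close>
    have b: "u (1 / (z0 + b)) \<le> \<epsilon> * m n (1 / (z0 + b)) / r ^ n" if b: "b \<in> A" for b
    proof (rule step)
      show "Q (\<delta> * (1 + \<kappa>) ^ n) (1 / (z0 + b)) (1 / (p0 + b))"
        using inv(2)[OF z0 b] inv(2)[OF p0(1) b] zero[OF p0] b far Re_branch[OF z0 b] Re_branch[OF p0(1) b]
        by (auto simp: Q_def)
    qed
    have "u z0 \<le> \<epsilon> * m (Suc n) z0 / r ^ Suc n" by (rule one_step[OF z0 p0 b \<epsilon>])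
    also have "\<dots> \<le> \<epsilon> * (bnd \<rho> * r ^ Suc n) / r ^ Suc n"
      using m_upper[OF hp[OF z0] \<rho>[OF z0], of "Suc n"] \<epsilon> r_pos
      by (intro divide_right_mono mult_left_mono) auto
    finally show ?thesis using r_pos by simp
  qed
  have "u z0 \<le> 0"
  proof (rule field_le_epsilon)
    fix e :: real assume "e > 0"
    then show "u z0 \<le> 0 + e" using main[of "e / bnd \<rho>"] bnd_pos[OF \<rho>0] by simp
  qed
  then show ?thesis using u(2)[OF z0] by simp
qed

lemma eigenfunction_unique:
  fixes S :: "complex set" and v :: "complex \<Rightarrow> real"
  assumes S: "compact S" "S \<subseteq> {z. Re z \<ge> 0}" "invariant S"
    and v: "continuous_on S v" "\<And>z. z \<in> S \<Longrightarrow> T v z = r * v z"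
  shows "\<exists>c. \<forall>z\<in>S. v z = c * w z"
proof -
  have hp: "z \<in> hp" if "z \<in> S" for z using that S(2) by auto
  have wc: "continuous_on S w"
    using continuous_on_subset[OF W_continuous[of "[]"], of S] hp unfolding W_Nil by blast
  have wp: "w z > 0" if "z \<in> S" for z using w_pos hp that by blast
  have "S \<noteq> {}" using S(3) by (auto simp: invariant_def)
  moreover have "continuous_on S (\<lambda>z. v z / w z)"
    using wp by (intro continuous_on_divide v wc) fastforce
  ultimately obtain p where p: "p \<in> S" "\<And>z. z \<in> S \<Longrightarrow> v p / w p \<le> v z / w z"
    using continuous_attains_inf[OF S(1)] by blast
  define c where "c = v p / w p"
  define u where "u z = v z - c * w z" for z
  have "u z = 0" if z: "z \<in> S" for z
  proof (rule eigenfunction_with_zero_vanishes[OF S _ _ _ p(1) _ z])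
    show "continuous_on S u" unfolding u_def by (intro continuous_intros v wc)
    show "u z \<ge> 0" if "z \<in> S" for z
      using p(2)[OF that] wp[OF that] by (simp add: u_def c_def[symmetric] le_divide_eq)
    show "T u z = r * u z" if "z \<in> S" for z
    proof -
      have "T u z = T v z - c * T w z"
        by (simp add: T_def u_def algebra_simps sum_subtractf sum_distrib_left)
      then show ?thesis using v(2)[OF that] T_w[OF hp[OF that]] by (simp add: u_def algebra_simps)
    qed
    show "u p = 0" using wp[OF p(1)] by (simp add: u_def c_def)
  qed
  then show ?thesis by (auto simp: u_def)
qed

end

section \<open>The complex operator and the growth of its norms\<close>

context transfer_op
begin

definition TC :: "(complex \<Rightarrow> complex) \<Rightarrow> complex \<Rightarrow> complex" where
  "TC f z = (\<Sum>b\<in>A. of_real (kern s (z + b)) * f (1 / (z + b))) + of_real \<alpha> * f 0"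

lemma TC_of_real: "TC (\<lambda>u. of_real (f u)) z = of_real (T f z)"
  by (simp add: TC_def T_def)

lemma TC_pow_of_real: "(TC ^^ k) (\<lambda>u. of_real (f u)) = (\<lambda>z. of_real ((T ^^ k) f z))"
  by (induction k) (simp_all add: TC_of_real)

lemma TC_pow_le: "cmod ((TC ^^ k) f z) \<le> (T ^^ k) (\<lambda>u. cmod (f u)) z"
proof (induction k arbitrary: z)
  case (Suc k)
  let ?g = "(TC ^^ k) f" and ?h = "(T ^^ k) (\<lambda>u. cmod (f u))"
  have "cmod (TC ?g z) \<le> (\<Sum>b\<in>A. cmod (of_real (kern s (z + b)) * ?g (1 / (z + b)))) + cmod (of_real \<alpha> * ?g 0)"
    unfolding TC_def by (intro order_trans[OF norm_triangle_ineq] add_mono norm_sum order_refl)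
  also have "\<dots> \<le> T ?h z"
    unfolding T_def[of ?h] norm_mult norm_of_real using \<alpha> Suc.IH
    by (intro add_mono sum_mono mult_mono) auto
  finally show ?case by simp
qed simp

end

lemma supn_ge:
  assumes "compact S" "continuous_on S f" "z \<in> S"
  shows "cmod (f z) \<le> supn S f"
proof -
  have "compact ((\<lambda>z. cmod (f z)) ` S)" using assms by (intro compact_continuous_image continuous_intros)
  then show ?thesis unfolding supn_def using assms(3)
    by (intro cSup_upper) (auto simp: bounded_imp_bdd_above compact_imp_bounded)
qed

context transfer_limit
begin

text \<open>By positivity the constant 1 is extremal: \<open>TC^k f\<close> is dominated by
  \<open>m k\<close> on the unit ball, and \<open>f = 1\<close> evaluated at 0 gives
  \<open>m k 0\<close>. Both are comparable to \<open>r ^ k\<close>.\<close>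

lemma spectral_radius:
  assumes S: "compact S" "S \<subseteq> {z. Re z \<ge> 0}" "invariant S"
  shows "(\<lambda>k. opnorm_pow S TC k powr (1 / real k)) \<longlonglongrightarrow> r"
proof -
  have hp: "z \<in> hp" if "z \<in> S" for z using that S(2) by auto
  have S0: "0 \<in> S" using S(3) by (simp add: invariant_def)
  obtain \<rho> where \<rho>: "\<And>z. z \<in> S \<Longrightarrow> cmod z \<le> \<rho>"
    using compact_imp_bounded[OF S(1)] unfolding bounded_iff by blast
  have \<rho>0: "\<rho> \<ge> 0" using \<rho>[OF S0] by simp
  have le: "cmod ((TC ^^ k) f z) \<le> bnd \<rho> * r ^ k"
    if f: "continuous_on S f" "supn S f \<le> 1" and z: "z \<in> S" for f z k
  proof -
    have "cmod (f u) \<le> 1 * 1" if "u \<in> S" for u using supn_ge[OF S(1) f(1) that] f(2) by simp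
    then have "(T ^^ k) (\<lambda>u. cmod (f u)) z \<le> 1 * (T ^^ k) (\<lambda>_. 1) z"
      by (intro Tpow_mono[OF S(3)] z) auto
    then show ?thesis
      using TC_pow_le[of k f z] m_upper[OF hp[OF z] \<rho>[OF z], of k] by (simp add: m_def)
  qed
  have sup_le: "supn S ((TC ^^ k) f) \<le> bnd \<rho> * r ^ k"
    if f: "continuous_on S f" "supn S f \<le> 1" for f k
    unfolding supn_def using S0 le[OF f] by (intro cSUP_least) auto
  have one: "supn S (\<lambda>_. 1) \<le> 1" unfolding supn_def using S0 by (intro cSUP_least) auto
  have upper: "opnorm_pow S TC k \<le> bnd \<rho> * r ^ k" for k
    unfolding opnorm_pow_def
  proof (rule cSup_least)
    have "supn S ((TC ^^ k) (\<lambda>_. 1)) \<in> {supn S ((TC ^^ k) f) |f. continuous_on S f \<and> supn S f \<le> 1}"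
      using one continuous_on_const by blast
    then show "{supn S ((TC ^^ k) f) |f. continuous_on S f \<and> supn S f \<le> 1} \<noteq> {}" by blast
  qed (use sup_le in blast)
  have lower: "m k 0 \<le> opnorm_pow S TC k" for k
  proof -
    have eq: "(TC ^^ k) (\<lambda>_. 1) = (\<lambda>z. of_real (m k z))"
      using TC_pow_of_real[of k "\<lambda>_. 1"] by (simp add: m_def)
    have "m k 0 \<le> cmod ((TC ^^ k) (\<lambda>_. 1) 0)" unfolding eq by simp
    \<comment> \<open>\<open>Sup\<close> dominates its elements only for sets bounded above; the
      upper estimate just proved provides the bound, here and in the next step.\<close>
    also have "\<dots> \<le> supn S ((TC ^^ k) (\<lambda>_. 1))"
      unfolding supn_def using S0 le[OF continuous_on_const one]
      by (intro cSUP_upper bdd_aboveI2[of _ _ "bnd \<rho> * r ^ k"]) auto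
    also have "\<dots> \<le> opnorm_pow S TC k"
      unfolding opnorm_pow_def
    proof (rule cSup_upper)
      show "supn S ((TC ^^ k) (\<lambda>_. 1)) \<in> {supn S ((TC ^^ k) f) |f. continuous_on S f \<and> supn S f \<le> 1}"
        using one continuous_on_const by blast
      show "bdd_above {supn S ((TC ^^ k) f) |f. continuous_on S f \<and> supn S f \<le> 1}"
        using sup_le by (intro bdd_aboveI[of _ "bnd \<rho> * r ^ k"]) blast
    qed
    finally show ?thesis .
  qed
  define K where "K = max (bnd \<rho>) (3 powr (2 * s))"
  show ?thesis
  proof (rule root_limit_of_geometric_bounds[OF r_pos])
    show K: "K > 0" using bnd_pos[OF \<rho>0] by (simp add: K_def)
    fix k
    show "opnorm_pow S TC k \<le> K * r ^ k"
      using r_pos by (intro order_trans[OF upper] mult_right_mono) (auto simp: K_def)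
    have "3 powr (2 * s) * m k 0 \<le> K * opnorm_pow S TC k"
      using lower[of k] K m_pos[of 0 k] by (intro mult_mono) (auto simp: K_def)
    then show "r ^ k \<le> K * opnorm_pow S TC k" using r_lower[of k] by linarith
  qed
qed

end

section \<open>The disk and the closure of the domain\<close>

lemma closure_interior_diskD: "closure (interior diskD) = diskD"
proof -
  have eq: "diskD = cball (1/2) (1/2)"
  proof (rule set_eqI)
    fix z
    have "z \<in> cball (1/2) (1/2) \<longleftrightarrow> (cmod (z - 1/2))^2 \<le> (1/2)^2"
      by (simp add: dist_norm norm_minus_commute abs_le_square_iff[symmetric])
    also have "\<dots> \<longleftrightarrow> z \<in> diskD" by (simp add: diskD_def cmod_power2 power_divide)
    finally show "z \<in> diskD \<longleftrightarrow> z \<in> cball (1/2) (1/2)" by blast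
  qed
  show ?thesis unfolding eq interior_cball by (rule closure_ball) simp
qed

text \<open>Source of the invariance of the closure of \<open>U\<close>: each \<open>z + b\<close>
  has real part at least 1, so every branch lands in the disk.\<close>

lemma reciprocal_in_diskD:
  assumes "Re \<zeta> \<ge> 1"
  shows "1 / \<zeta> \<in> diskD"
proof -
  have "(Re (inverse \<zeta>))^2 + (Im (inverse \<zeta>))^2 \<le> Re (inverse \<zeta>)"
    using inverse_in_disk[of 1 \<zeta>] assms by simp
  then show ?thesis unfolding inverse_eq_divide diskD_def
    by (simp add: power2_eq_square algebra_simps)
qed

text \<open>Identifies an arbitrary continuous extension of a derivative of the eigenfunction with
  the one furnished by \<open>W\<close>, which is what (iv) and (v) are proved for.\<close>

lemma continuous_extension_unique:
  fixes g h :: "complex \<Rightarrow> real"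
  assumes "continuous_on (closure U) g" "continuous_on (closure U) h"
    and "\<And>z. z \<in> U \<Longrightarrow> g z = h z" and z: "z \<in> closure U"
  shows "g z = h z"
proof -
  have "continuous_on (closure U) (\<lambda>z. g z - h z)" using assms by (intro continuous_intros)
  then have "g z - h z = 0"
    by (rule continuous_constant_on_closure) (use assms in auto)
  then show ?thesis by simp
qed

theorem theorem3p1:
  fixes U B :: "complex set" and \<gamma> R \<alpha> s :: real
  assumes U: "bounded U" "open U" "mildly_regular U"
    and DU: "interior diskD \<subseteq> U"
    and Upos: "\<forall>z\<in>U. Re z > 0"
    and \<gamma>: "\<gamma> \<ge> 1"
    and B: "finite B" "\<forall>b\<in>B. Re b \<ge> \<gamma>"
    and R: "R > 0" and \<alpha>: "\<alpha> \<ge> 0"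
    and nontriv: "\<alpha> > 0 \<or> {b\<in>B. cmod b \<le> R} \<noteq> {}"
    and s: "s \<ge> 0"
  shows "\<exists>r w. r > 0 \<and>
     (\<lambda>k. opnorm_pow (closure U) (Lop B R \<alpha> s) k powr (1 / real k)) \<longlonglongrightarrow> r \<and>
     continuous_on (closure U) w \<and> (\<forall>z\<in>closure U. w z > 0) \<and>
     (\<forall>z\<in>closure U. Lop B R \<alpha> s (\<lambda>u. complex_of_real (w u)) z = complex_of_real (r * w z)) \<and>
     (\<forall>v. continuous_on (closure U) v \<and> (\<forall>z\<in>closure U. v z > 0) \<and>
          (\<forall>z\<in>closure U. Lop B R \<alpha> s (\<lambda>u. complex_of_real (v u)) z = complex_of_real (r * v z))
          \<longrightarrow> (\<exists>c. \<forall>z\<in>closure U. v z = c * w z)) \<and>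
     (((\<forall>b\<in>B. cnj b \<in> B) \<and> (\<forall>z\<in>U. cnj z \<in> U)) \<longrightarrow> (\<forall>z\<in>closure U. w (cnj z) = w z)) \<and>
     (\<forall>ds. set ds \<subseteq> {1, \<i>} \<longrightarrow>
        (\<forall>z\<in>U. \<forall>d\<in>{1, \<i>}. (\<lambda>t::real. pder ds w (z + complex_of_real t * d)) differentiable (at 0)) \<and>
        (\<exists>g. continuous_on (closure U) g \<and> (\<forall>z\<in>U. g z = pder ds w z))) \<and>
     (\<forall>z0\<in>closure U. \<forall>z1\<in>closure U.
        w z0 \<le> w z1 * exp ((sqrt 5 * s / \<gamma>) * cmod (z1 - z0))) \<and>
     (\<forall>x1 x2 y. 0 \<le> x1 \<and> x1 \<le> x2 \<and> Complex x1 y \<in> closure U \<and> Complex x2 y \<in> closure U \<longrightarrow>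
        w (Complex x2 y) \<le> w (Complex x1 y) \<and>
        w (Complex x1 y) * exp ((- 2 * s / \<gamma>) * (x2 - x1)) \<le> w (Complex x2 y)) \<and>
     (\<forall>x y1 y2. Complex x y1 \<in> closure U \<and> Complex x y2 \<in> closure U \<longrightarrow>
        w (Complex x y1) \<le> w (Complex x y2) * exp ((s / \<gamma>) * \<bar>y1 - y2\<bar>)) \<and>
     (\<forall>g. continuous_on (closure U) g \<and> (\<forall>z\<in>U. g z = pder [1, 1] w z) \<longrightarrow>
        (\<forall>z\<in>closure U. - (s / (4 * \<gamma>^2 * (s + 1))) * w z \<le> g z \<and>
                         g z \<le> (2 * s * (2 * s + 1) / \<gamma>^2) * w z)) \<and>
     (\<forall>g. continuous_on (closure U) g \<and> (\<forall>z\<in>U. g z = pder [\<i>, \<i>] w z) \<longrightarrow>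
        (\<forall>z\<in>closure U. - (2 * s / \<gamma>^2) * w z \<le> g z \<and>
                         g z \<le> (2 * s * (2 * s + 1) / (4 * \<gamma>^2)) * w z))"
proof -
  define A where "A = {b \<in> B. cmod b \<le> R}"
  define S where "S = closure U"
  interpret op: transfer_op A \<gamma> \<alpha> s
    using B \<gamma> \<alpha> s nontriv by unfold_locales (auto simp: A_def)
  obtain r where r: "r > 0" "\<And>k. r ^ k \<le> 3 powr (2 * s) * op.m k 0"
    "\<And>k. op.m k 0 \<le> 3 powr (2 * s) * r ^ k"
    using op.growth_rate_exists by blast
  obtain Lm where "banach_limit Lm" using banach_limit_exists by blast
  then interpret tl: transfer_limit A \<gamma> \<alpha> s Lm r
    by (intro transfer_limit.intro op.transfer_op_axioms transfer_limit_axioms.intro) (use r in auto)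
  let ?w = tl.w
  \<comment> \<open>The equality holds at every point: at a pole \<open>z = -b\<close> both weights
    are 0, by the conventions for division and \<open>powr\<close> at 0.\<close>
  have Lop_eq: "Lop B R \<alpha> s = op.TC"
    unfolding Lop_def op.TC_def fun_eq_iff A_def[symmetric] kern_def
    by (simp add: powr_minus divide_inverse mult.commute)
  have cS: "compact S" unfolding S_def using U(1) by (simp add: compact_closure)
  have SRe: "S \<subseteq> {z. Re z \<ge> 0}"
    unfolding S_def using Upos by (intro closure_minimal closed_halfspace_Re_ge) auto
  have DS: "diskD \<subseteq> S" unfolding S_def using closure_mono[OF DU] by (simp add: closure_interior_diskD)
  have inv: "op.invariant S"
    unfolding op.invariant_def
  proof (intro conjI ballI)
    have "(0::complex) \<in> diskD" by (simp add: diskD_def power2_eq_square)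
    then show "0 \<in> S" using DS by blast
    fix z b assume "z \<in> S" "b \<in> A"
    then have "Re (z + b) \<ge> 1" using SRe op.A[of b] \<gamma> by fastforce
    then show "1 / (z + b) \<in> S" using reciprocal_in_diskD DS by blast
  qed
  have hp: "z \<in> hp" if "z \<in> S" for z using that SRe by auto
  have US: "U \<subseteq> S" unfolding S_def by (rule closure_subset)
  have W_cont: "continuous_on S (tl.W ds)" for ds
    using continuous_on_subset[OF tl.W_continuous[of ds], of S] hp by blast
  have g0: "\<gamma> > 0" using \<gamma> by simp
  have shift: "Re (z + \<beta>) \<ge> \<gamma>" if "z \<in> S" "Re \<beta> \<ge> \<gamma>" for z \<beta> using that SRe by fastforce
  have nz: "z + \<beta> \<noteq> 0" if "z \<in> S" "Re \<beta> \<ge> \<gamma>" for z \<beta>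
    using op.hp_shift_nonzero[OF hp] that by blast
  \<comment> \<open>The kernel has exponent \<open>2 s\<close> and moduli vary by the factor
    \<open>exp (|z1 - z0| / \<gamma>)\<close>. The constant \<open>2 s / \<gamma>\<close> is sharper
    than that of (i) and also serves the lower bound in (ii).\<close>
  have lip: "?w z0 \<le> exp (2 * s / \<gamma> * cmod (z1 - z0)) * ?w z1" if z: "z0 \<in> S" "z1 \<in> S" for z0 z1
  proof (rule tl.w_harnack[OF hp[OF z(1)] hp[OF z(2)]])
    show "1 \<le> exp (2 * s / \<gamma> * cmod (z1 - z0))" using s g0 by simp
    fix \<beta> assume \<beta>: "Re \<beta> \<ge> \<gamma>"
    have "kern s (z0 + \<beta>) \<le> exp (cmod (z1 + \<beta> - (z0 + \<beta>)) / \<gamma>) powr (2 * s) * kern s (z1 + \<beta>)"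
      using s nz z \<beta> by (intro kern_harnack norm_shift_exp g0 shift) auto
    then show "kern s (z0 + \<beta>) \<le> exp (2 * s / \<gamma> * cmod (z1 - z0)) * kern s (z1 + \<beta>)"
      by (simp add: exp_powr_real mult_ac)
  qed
  show ?thesis
    unfolding S_def[symmetric] Lop_eq op.TC_of_real of_real_eq_iff
  proof (intro exI[of _ r] exI[of _ ?w] conjI)
    show "r > 0" by (rule r(1))
    show "(\<lambda>k. opnorm_pow S op.TC k powr (1 / real k)) \<longlonglongrightarrow> r"
      by (rule tl.spectral_radius[OF cS SRe inv])
    show "continuous_on S ?w" using W_cont[of "[]"] by (simp add: tl.W_Nil)
    show "\<forall>z\<in>S. 0 < ?w z" using tl.w_pos hp by blast
    show "\<forall>z\<in>S. op.T ?w z = r * ?w z" using tl.T_w hp by blast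
    show "\<forall>v. continuous_on S v \<and> (\<forall>z\<in>S. 0 < v z) \<and> (\<forall>z\<in>S. op.T v z = r * v z) \<longrightarrow>
      (\<exists>c. \<forall>z\<in>S. v z = c * ?w z)"
      using tl.eigenfunction_unique[OF cS SRe inv] by blast
    show "(\<forall>b\<in>B. cnj b \<in> B) \<and> (\<forall>z\<in>U. cnj z \<in> U) \<longrightarrow> (\<forall>z\<in>S. ?w (cnj z) = ?w z)"
      using tl.w_cnj by (auto simp: A_def)
    show "\<forall>ds. set ds \<subseteq> {1, \<i>} \<longrightarrow>
        (\<forall>z\<in>U. \<forall>d\<in>{1, \<i>}. (\<lambda>t::real. pder ds ?w (z + complex_of_real t * d)) differentiable (at 0)) \<and>
        (\<exists>g. continuous_on S g \<and> (\<forall>z\<in>U. g z = pder ds ?w z))"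
    proof (intro allI impI conjI ballI)
      fix ds d z assume "z \<in> U"
      then show "(\<lambda>t::real. pder ds ?w (z + complex_of_real t * d)) differentiable (at 0)"
        using hp US by (intro tl.pder_w_differentiable) blast
    next
      fix ds
      show "\<exists>g. continuous_on S g \<and> (\<forall>z\<in>U. g z = pder ds ?w z)"
      proof (intro exI conjI ballI)
        show "continuous_on S (tl.W ds)" by (rule W_cont)
        show "tl.W ds z = pder ds ?w z" if "z \<in> U" for z
          using tl.pder_w[OF hp, of z ds] that US by auto
      qed
    qed
    show "\<forall>z0\<in>S. \<forall>z1\<in>S. ?w z0 \<le> ?w z1 * exp (sqrt 5 * s / \<gamma> * cmod (z1 - z0))"
    proof (intro ballI)
      fix z0 z1 assume z: "z0 \<in> S" "z1 \<in> S"
      have "2 * s / \<gamma> \<le> sqrt 5 * s / \<gamma>"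
        using s g0 by (intro divide_right_mono mult_right_mono real_le_rsqrt) auto
      then have "exp (2 * s / \<gamma> * cmod (z1 - z0)) \<le> exp (sqrt 5 * s / \<gamma> * cmod (z1 - z0))"
        unfolding exp_le_cancel_iff by (rule mult_right_mono) simp
      then have "exp (2 * s / \<gamma> * cmod (z1 - z0)) * ?w z1 \<le> exp (sqrt 5 * s / \<gamma> * cmod (z1 - z0)) * ?w z1"
        using tl.w_pos[OF hp[OF z(2)]] by (intro mult_right_mono) auto
      then show "?w z0 \<le> ?w z1 * exp (sqrt 5 * s / \<gamma> * cmod (z1 - z0))"
        using lip[OF z] by (simp add: mult.commute)
    qed
    show "\<forall>x1 x2 y. 0 \<le> x1 \<and> x1 \<le> x2 \<and> Complex x1 y \<in> S \<and> Complex x2 y \<in> S \<longrightarrow>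
        ?w (Complex x2 y) \<le> ?w (Complex x1 y) \<and>
        ?w (Complex x1 y) * exp (- 2 * s / \<gamma> * (x2 - x1)) \<le> ?w (Complex x2 y)"
    proof (intro allI impI)
      fix x1 x2 y
      assume "0 \<le> x1 \<and> x1 \<le> x2 \<and> Complex x1 y \<in> S \<and> Complex x2 y \<in> S"
      then have x: "0 \<le> x1" "x1 \<le> x2" and z: "Complex x1 y \<in> S" "Complex x2 y \<in> S" by auto
      have "?w (Complex x2 y) \<le> 1 * ?w (Complex x1 y)"
      proof (rule tl.w_harnack[OF hp[OF z(2)] hp[OF z(1)]])
        fix \<beta> assume \<beta>: "Re \<beta> \<ge> \<gamma>"
        \<comment> \<open>A shift to the right enlarges a nonnegative real part, hence the modulus,
          and so lowers the kernel.\<close>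
        have "cmod (Complex x1 y + \<beta>) \<le> cmod (Complex x2 y + \<beta>)"
          unfolding cmod_def using x \<beta> g0 by (intro real_sqrt_le_mono add_right_mono power_mono) auto
        then show "kern s (Complex x2 y + \<beta>) \<le> 1 * kern s (Complex x1 y + \<beta>)"
          using kern_antimono[OF s nz[OF z(1) \<beta>]] by simp
      qed simp
      moreover have "cmod (Complex x2 y - Complex x1 y) = x2 - x1"
        using x by (simp add: complex_diff cmod_def)
      then have "?w (Complex x1 y) \<le> exp (2 * s / \<gamma> * (x2 - x1)) * ?w (Complex x2 y)"
        using lip[OF z] by simp
      then have "?w (Complex x1 y) * exp (- 2 * s / \<gamma> * (x2 - x1)) \<le> ?w (Complex x2 y)"
        by (simp add: exp_minus field_simps)
      ultimately show "?w (Complex x2 y) \<le> ?w (Complex x1 y) \<and>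
        ?w (Complex x1 y) * exp (- 2 * s / \<gamma> * (x2 - x1)) \<le> ?w (Complex x2 y)" by simp
    qed
    show "\<forall>x y1 y2. Complex x y1 \<in> S \<and> Complex x y2 \<in> S \<longrightarrow>
        ?w (Complex x y1) \<le> ?w (Complex x y2) * exp (s / \<gamma> * \<bar>y1 - y2\<bar>)"
    proof (intro allI impI)
      fix x y1 y2 assume "Complex x y1 \<in> S \<and> Complex x y2 \<in> S"
      then have z: "Complex x y1 \<in> S" "Complex x y2 \<in> S" by auto
      have "?w (Complex x y1) \<le> exp (s / \<gamma> * \<bar>y1 - y2\<bar>) * ?w (Complex x y2)"
      proof (rule tl.w_harnack[OF hp[OF z(1)] hp[OF z(2)]])
        show "1 \<le> exp (s / \<gamma> * \<bar>y1 - y2\<bar>)" using s g0 by simp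
        fix \<beta> assume \<beta>: "Re \<beta> \<ge> \<gamma>"
        have e: "Complex x y + \<beta> = Complex (x + Re \<beta>) (y + Im \<beta>)" for y by (simp add: complex_eq_iff)
        have "cmod (Complex x y2 + \<beta>) \<le> exp (\<bar>y1 - y2\<bar> / (2 * \<gamma>)) * cmod (Complex x y1 + \<beta>)"
          using norm_vertical_shift[OF g0, of "x + Re \<beta>" "y2 + Im \<beta>" "y1 + Im \<beta>"] shift[OF z(1) \<beta>]
          unfolding e by simp
        then have "kern s (Complex x y1 + \<beta>) \<le> exp (\<bar>y1 - y2\<bar> / (2 * \<gamma>)) powr (2 * s) * kern s (Complex x y2 + \<beta>)"
          using s nz z \<beta> by (intro kern_harnack) auto
        then show "kern s (Complex x y1 + \<beta>) \<le> exp (s / \<gamma> * \<bar>y1 - y2\<bar>) * kern s (Complex x y2 + \<beta>)"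
          by (simp add: exp_powr_real mult_ac)
      qed
      then show "?w (Complex x y1) \<le> ?w (Complex x y2) * exp (s / \<gamma> * \<bar>y1 - y2\<bar>)"
        by (simp add: mult.commute)
    qed
    \<comment> \<open>On \<open>S\<close> the extension is a Banach limit of derivatives of cone
      elements, so the kernel bounds apply on the boundary directly.\<close>
    have ext: "g z = tl.W ds z"
      if "continuous_on S g" "\<And>z. z \<in> U \<Longrightarrow> g z = pder ds ?w z" "z \<in> S" for g ds z
    proof (rule continuous_extension_unique[of U])
      show "g u = tl.W ds u" if "u \<in> U" for u
        using tl.pder_w[OF hp, of u ds] that US \<open>\<And>z. z \<in> U \<Longrightarrow> g z = pder ds ?w z\<close> by auto
    qed (use that W_cont in \<open>auto simp: S_def\<close>)
    show "\<forall>g. continuous_on S g \<and> (\<forall>z\<in>U. g z = pder [1, 1] ?w z) \<longrightarrow>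
        (\<forall>z\<in>S. - (s / (4 * \<gamma>^2 * (s + 1))) * ?w z \<le> g z \<and> g z \<le> (2 * s * (2 * s + 1) / \<gamma>^2) * ?w z)"
    proof (intro allI impI ballI)
      fix g z assume g: "continuous_on S g \<and> (\<forall>z\<in>U. g z = pder [1, 1] ?w z)" and z: "z \<in> S"
      have "g z = tl.W [1, 1] z" by (rule ext) (use g z in auto)
      moreover have "- (s / (4 * \<gamma>^2 * (s + 1))) \<le> 0" "2 * s * (2 * s + 1) / \<gamma>^2 \<ge> 0" using s by auto
      ultimately show "- (s / (4 * \<gamma>^2 * (s + 1))) * ?w z \<le> g z \<and> g z \<le> (2 * s * (2 * s + 1) / \<gamma>^2) * ?w z"
        using tl.W_le[OF hp[OF z], of "[1, 1]" "- (s / (4 * \<gamma>^2 * (s + 1)))" "2 * s * (2 * s + 1) / \<gamma>^2"]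
          pder_kern_xx_bounds[OF g0 shift[OF z] s] by (metis list.distinct(1))
    qed
    show "\<forall>g. continuous_on S g \<and> (\<forall>z\<in>U. g z = pder [\<i>, \<i>] ?w z) \<longrightarrow>
        (\<forall>z\<in>S. - (2 * s / \<gamma>^2) * ?w z \<le> g z \<and> g z \<le> (2 * s * (2 * s + 1) / (4 * \<gamma>^2)) * ?w z)"
    proof (intro allI impI ballI)
      fix g z assume g: "continuous_on S g \<and> (\<forall>z\<in>U. g z = pder [\<i>, \<i>] ?w z)" and z: "z \<in> S"
      have "g z = tl.W [\<i>, \<i>] z" by (rule ext) (use g z in auto)
      moreover have "- (2 * s / \<gamma>^2) \<le> 0" "2 * s * (2 * s + 1) / (4 * \<gamma>^2) \<ge> 0" using s by auto
      ultimately show "- (2 * s / \<gamma>^2) * ?w z \<le> g z \<and> g z \<le> (2 * s * (2 * s + 1) / (4 * \<gamma>^2)) * ?w z"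
        using tl.W_le[OF hp[OF z], of "[\<i>, \<i>]" "- (2 * s / \<gamma>^2)" "2 * s * (2 * s + 1) / (4 * \<gamma>^2)"]
          pder_kern_yy_bounds[OF g0 shift[OF z] s] by (metis list.distinct(1))
    qed
  qed
qed

end
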